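(* Let $\mathcal{C}$ be a set and let $H\subset\mathrm{Mag}_3(\mathcal{C})$ be a Hall triple set over $\mathcal{C}$. Then $H$ is a basis for the free Lie triple system $\mathrm{LTS}(\mathcal{C})$; that is, the residue classes of the elements of $H$ form a vector space basis of $\mathrm{LTS}(\mathcal{C})=\mathrm{Alg}_3(\mathcal{C})/\mathcal{M}$.
   Context: Work over some field $K$. A Lie triple system is a vector space with a trilinear bracket satisfying (1) $[x,y,z]=-[y,x,z]$, (2) $[x,y,z]+[y,z,x]+[z,x,y]=0$, (3) $[u,v,[x,y,z]]=[[u,v,x],y,z]+[x,[u,v,y],z]+[x,y,[u,v,z]]$. $\mathrm{Mag}_3(\mathcal{C})$ is the free ternary magma on $\mathcal{C}$, i.e. the set of all formal iterated triple brackets $[\cdot,\cdot,\cdot]$ of elements of $\mathcal{C}$, with degree $|c|=1$ for $c\in\mathcal{C}$ and $|[a,b,c]|=|a|+|b|+|c|$. $\mathrm{Alg}_3(\mathcal{C})$ is the vector space over $K$ with basis $\mathrm{Mag}_3(\mathcal{C})$ with the trilinear extension of the bracket, and $\mathcal{M}\subset\mathrm{Alg}_3(\mathcal{C})$ is the ideal generated by the relations (1)–(3), so that $\mathrm{LTS}(\mathcal{C})=\mathrm{Alg}_3(\mathcal{C})/\mathcal{M}$. A Hall triple set over $\mathcal{C}$ is a set $H$ with $\mathcal{C}\subset H\subset\mathrm{Mag}_3(\mathcal{C})$ together with a total order $<$ on $H$ such that $|u|<|v|$ implies $u<v$ (the order within a degree is arbitrary), and such that $[u,v,w]\in H$ if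 and only if $u,v,w\in H$, $u>v\le w$, and one of the following holds: either $u\in\mathcal{C}$, or $u=[a,b,c]$ with $c\le v$. *)

theory Defs
  imports
    "HOL-Library.Poly_Mapping"
    "HOL-Algebra.AbelCoset"
    "Jordan_Normal_Form.VS_Connect"
begin

section \<open>The free ternary magma and its linearization\<close>

datatype (gens: 'c) mag3 = Gen 'c | Br "'c mag3" "'c mag3" "'c mag3"

primrec deg :: "'c mag3 \<Rightarrow> nat" where
  "deg (Gen c) = 1"
| "deg (Br a b c) = deg a + deg b + deg c"

definition Mag3 :: "'c set \<Rightarrow> 'c mag3 set" where
  "Mag3 C = {t. gens t \<subseteq> C}"

text \<open>
  Vectors with basis \<^term>\<open>Mag3 C\<close> are the finitely supported functions on \<^typ>\<open>'c mag3\<close> whose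
  support lies in \<^term>\<open>Mag3 C\<close>. The multiplicative fields of the module record play no role.
\<close>

definition Alg3 :: "'c set \<Rightarrow> ('k::field, 'c mag3 \<Rightarrow>\<^sub>0 'k) module" where
  "Alg3 C = \<lparr>carrier = {p. Poly_Mapping.keys p \<subseteq> Mag3 C},
     mult = undefined, one = undefined, zero = 0, add = (+),
     smult = (\<lambda>k. Poly_Mapping.map ((*) k))\<rparr>"

definition br :: "('c mag3 \<Rightarrow>\<^sub>0 'k::field) \<Rightarrow> ('c mag3 \<Rightarrow>\<^sub>0 'k) \<Rightarrow> ('c mag3 \<Rightarrow>\<^sub>0 'k) \<Rightarrow> ('c mag3 \<Rightarrow>\<^sub>0 'k)" where
  "br p q r = (\<Sum>x\<in>Poly_Mapping.keys p. \<Sum>y\<in>Poly_Mapping.keys q. \<Sum>z\<in>Poly_Mapping.keys r.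
     Poly_Mapping.single (Br x y z)
       (Poly_Mapping.lookup p x * Poly_Mapping.lookup q y * Poly_Mapping.lookup r z))"


section \<open>The free Lie triple system\<close>

definition ideal3 :: "'c set \<Rightarrow> ('c mag3 \<Rightarrow>\<^sub>0 'k::field) set \<Rightarrow> bool" where
  "ideal3 C I \<longleftrightarrow> subspace (class_ring :: 'k ring) I (Alg3 C) \<and>
     (\<forall>m\<in>I. \<forall>p\<in>carrier (Alg3 C). \<forall>q\<in>carrier (Alg3 C).
        br m p q \<in> I \<and> br p m q \<in> I \<and> br p q m \<in> I)"

definition LTS_relators :: "'c set \<Rightarrow> ('c mag3 \<Rightarrow>\<^sub>0 'k::field) set" where
  "LTS_relators C =
     {br x y z + br y x z | x y z. {x, y, z} \<subseteq> carrier (Alg3 C)}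
   \<union> {br x y z + br y z x + br z x y | x y z. {x, y, z} \<subseteq> carrier (Alg3 C)}
   \<union> {br u v (br x y z) - (br (br u v x) y z + br x (br u v y) z + br x y (br u v z))
        | u v x y z. {u, v, x, y, z} \<subseteq> carrier (Alg3 C)}"

definition LTS_ideal :: "'c set \<Rightarrow> ('c mag3 \<Rightarrow>\<^sub>0 'k::field) set" where
  "LTS_ideal C = ideal3 C hull LTS_relators C"

text \<open>
  The quotient vector space on the set of cosets. Scaling is written as a union over representatives,
  so that \<open>0\<close> times a coset is the ideal itself and not the set \<open>{0}\<close>.
\<close>

definition LTS :: "'c set \<Rightarrow> ('k::field, ('c mag3 \<Rightarrow>\<^sub>0 'k) set) module" where
  "LTS C = \<lparr>carrier = A_RCOSETS (Alg3 C) (LTS_ideal C),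
     mult = undefined, one = undefined, zero = LTS_ideal C, add = set_add (Alg3 C),
     smult = (\<lambda>k A. \<Union>p\<in>A. a_r_coset (Alg3 C) (LTS_ideal C) (k \<odot>\<^bsub>Alg3 C\<^esub> p))\<rparr>"

definition residue :: "'c set \<Rightarrow> 'c mag3 \<Rightarrow> ('c mag3 \<Rightarrow>\<^sub>0 'k::field) set" where
  "residue C t = a_r_coset (Alg3 C) (LTS_ideal C) (Poly_Mapping.single t 1)"


section \<open>Hall triple sets\<close>

text \<open>The strict order \<open>lt\<close> only matters on \<open>H\<close>; its values elsewhere are arbitrary.\<close>

definition hall_triple_set :: "'c set \<Rightarrow> 'c mag3 set \<Rightarrow> ('c mag3 \<Rightarrow> 'c mag3 \<Rightarrow> bool) \<Rightarrow> bool" where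
  "hall_triple_set C H lt \<longleftrightarrow>
     Gen ` C \<subseteq> H \<and> H \<subseteq> Mag3 C \<and>
     irreflp_on H lt \<and> transp_on H lt \<and> totalp_on H lt \<and>
     (\<forall>u\<in>H. \<forall>v\<in>H. deg u < deg v \<longrightarrow> lt u v) \<and>
     (\<forall>u v w. Br u v w \<in> H \<longleftrightarrow>
        u \<in> H \<and> v \<in> H \<and> w \<in> H \<and> lt v u \<and> (v = w \<or> lt v w) \<and>
        ((\<exists>c\<in>C. u = Gen c) \<or> (\<exists>a b c. u = Br a b c \<and> (c = v \<or> lt c v))))"


section \<open>Well-definedness\<close>

lemma Alg3_simps [simp]:
  "carrier (Alg3 C) = {p. Poly_Mapping.keys p \<subseteq> Mag3 C}"
  "zero (Alg3 C) = 0" "add (Alg3 C) = (+)"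
  "smult (Alg3 C) = (\<lambda>k. Poly_Mapping.map ((*) k))"
  by (simp_all add: Alg3_def)

lemma lookup_scale [simp]:
  "Poly_Mapping.lookup (Poly_Mapping.map ((*) k) p) t = k * Poly_Mapping.lookup p (t :: 'c mag3)"
  for k :: "'k::field"
  by (simp add: Poly_Mapping.map.rep_eq when_def)

lemma keys_scale: "Poly_Mapping.keys (Poly_Mapping.map ((*) k) p) \<subseteq> Poly_Mapping.keys (p :: 'c mag3 \<Rightarrow>\<^sub>0 'k::field)"
  by (auto simp: in_keys_iff)

lemma vectorspace_Alg3: "vectorspace (class_ring :: 'k::field ring) (Alg3 C :: (_, 'c mag3 \<Rightarrow>\<^sub>0 'k) module)"
proof -
  have ag: "abelian_group (Alg3 C :: (_, 'c mag3 \<Rightarrow>\<^sub>0 'k) module)"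
  proof (rule abelian_groupI, goal_cases)
    case (1 x y) then show ?case using keys_add[of x y] by auto
  next
    case (6 x)
    then show ?case by (intro bexI[of _ "-x"]) (auto simp: subset_iff in_keys_iff)
  qed (auto simp: algebra_simps)
  have "module (class_ring :: 'k ring) (Alg3 C :: (_, 'c mag3 \<Rightarrow>\<^sub>0 'k) module)"
    by (rule moduleI[OF class_cring.is_cring ag])
      (use keys_scale in \<open>force simp: poly_mapping_eq_iff fun_eq_iff lookup_add algebra_simps\<close>)+
  then show ?thesis by (simp add: vectorspace_def class_field.field_axioms)
qed

lemma keys_br: "Poly_Mapping.keys (br p q r) \<subseteq>
    {Br x y z | x y z. x \<in> Poly_Mapping.keys p \<and> y \<in> Poly_Mapping.keys q \<and> z \<in> Poly_Mapping.keys r}"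
  unfolding br_def
  by (rule order_trans[OF keys_sum] UN_least)+ auto

lemma br_closed:
  assumes "p \<in> carrier (Alg3 C)" "q \<in> carrier (Alg3 C)" "r \<in> carrier (Alg3 C)"
  shows "br p q r \<in> carrier (Alg3 C)"
proof -
  have "t \<in> Mag3 C" if t: "t \<in> Poly_Mapping.keys (br p q r)" for t
  proof -
    obtain x y z where "t = Br x y z" "x \<in> Mag3 C" "y \<in> Mag3 C" "z \<in> Mag3 C"
      using keys_br[of p q r] t assms by (simp add: subset_iff) blast
    then show ?thesis by (simp add: Mag3_def)
  qed
  then show ?thesis by auto
qed

lemma subspace_Alg3_iff:
  "subspace (class_ring :: 'k::field ring) I (Alg3 C :: (_, 'c mag3 \<Rightarrow>\<^sub>0 'k) module) \<longleftrightarrow>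
     I \<subseteq> carrier (Alg3 C) \<and> 0 \<in> I \<and> (\<forall>p\<in>I. \<forall>q\<in>I. p + q \<in> I) \<and>
     (\<forall>k. \<forall>p\<in>I. Poly_Mapping.map ((*) k) p \<in> I)"
  using vectorspace_Alg3[where 'k='k and C=C]
  by (auto simp: subspace_def submodule_def vectorspace_def)

lemma ideal3_Alg3: "ideal3 C (carrier (Alg3 C :: ('k::field, 'c mag3 \<Rightarrow>\<^sub>0 'k) module))"
proof -
  interpret vectorspace "class_ring :: 'k ring" "Alg3 C :: (_, 'c mag3 \<Rightarrow>\<^sub>0 'k) module"
    by (rule vectorspace_Alg3)
  note cl = M.a_closed smult_closed M.zero_closed
  show ?thesis
    unfolding ideal3_def subspace_Alg3_iff
    by (intro conjI ballI allI subset_refl br_closed cl[unfolded Alg3_simps(2-4)]) simp_all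
qed

lemma relators_closed: "LTS_relators C \<subseteq> carrier (Alg3 C :: ('k::field, 'c mag3 \<Rightarrow>\<^sub>0 'k) module)"
proof -
  interpret vectorspace "class_ring :: 'k ring" "Alg3 C :: (_, 'c mag3 \<Rightarrow>\<^sub>0 'k) module"
    by (rule vectorspace_Alg3)
  note add = M.a_closed[unfolded Alg3_simps(3)]
  have minus: "p - q \<in> carrier (Alg3 C)"
    if "p \<in> carrier (Alg3 C)" "q \<in> carrier (Alg3 C)" for p q :: "'c mag3 \<Rightarrow>\<^sub>0 'k"
    using that keys_diff[of p q] by auto
  show ?thesis
    unfolding LTS_relators_def
    by (intro Un_least subsetI; elim CollectE exE conjE; hypsubst; intro add minus br_closed; blast)
qed

lemma ideal3_Inter:
  assumes "\<F> \<noteq> {}" and I: "\<And>I. I \<in> \<F> \<Longrightarrow> ideal3 C (I :: ('c mag3 \<Rightarrow>\<^sub>0 'k::field) set)"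
  shows "ideal3 C (\<Inter>\<F>)"
proof -
  have "\<Inter>\<F> \<subseteq> carrier (Alg3 C)"
    using assms unfolding ideal3_def subspace_Alg3_iff by (meson Inf_lower2 ex_in_conv)
  then show ?thesis
    using I unfolding ideal3_def subspace_Alg3_iff by (simp del: Alg3_simps)
qed

lemma LTS_ideal_closed: "LTS_ideal C \<subseteq> carrier (Alg3 C :: ('k::field, 'c mag3 \<Rightarrow>\<^sub>0 'k) module)"
  unfolding LTS_ideal_def by (intro hull_minimal relators_closed ideal3_Alg3)

lemma ideal3_LTS_ideal: "ideal3 C (LTS_ideal C :: ('c mag3 \<Rightarrow>\<^sub>0 'k::field) set)"
  unfolding LTS_ideal_def hull_def
  using ideal3_Alg3 relators_closed by (intro ideal3_Inter) blast+

lemma LTS_simps [simp]: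
  "carrier (LTS C) = A_RCOSETS (Alg3 C) (LTS_ideal C)"
  "zero (LTS C) = LTS_ideal C" "add (LTS C) = set_add (Alg3 C)"
  "smult (LTS C) = (\<lambda>k A. \<Union>p\<in>A. a_r_coset (Alg3 C) (LTS_ideal C) (k \<odot>\<^bsub>Alg3 C\<^esub> p))"
  by (simp_all add: LTS_def)

lemma coset_eq: "a_r_coset (Alg3 C) I p = {m + p | m. m \<in> I}"
  by (auto simp: a_r_coset_def r_coset_def)

lemma vectorspace_LTS:
  "vectorspace (class_ring :: 'k::field ring) (LTS C :: (_, ('c mag3 \<Rightarrow>\<^sub>0 'k) set) module)"
proof -
  let ?A = "Alg3 C :: (_, 'c mag3 \<Rightarrow>\<^sub>0 'k) module" and ?K = "class_ring :: 'k ring"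
  let ?M = "LTS_ideal C :: ('c mag3 \<Rightarrow>\<^sub>0 'k) set"
  interpret A: vectorspace ?K ?A by (rule vectorspace_Alg3)
  have M: "subspace ?K ?M ?A"
    using ideal3_LTS_ideal[of C, where ?'k = 'k] unfolding ideal3_def by blast
  have Ms: "m \<in> ?M \<Longrightarrow> Poly_Mapping.map ((*) k) m \<in> ?M"
    and Ma: "m \<in> ?M \<Longrightarrow> m' \<in> ?M \<Longrightarrow> m + m' \<in> ?M" and M0: "0 \<in> ?M" for m m' k
    using M unfolding subspace_Alg3_iff by auto
  have scale_diff: "Poly_Mapping.map ((*) k) (p + q) = Poly_Mapping.map ((*) k) p + Poly_Mapping.map ((*) k) q"
    for k and p q :: "'c mag3 \<Rightarrow>\<^sub>0 'k"
    by (simp add: poly_mapping_eq_iff fun_eq_iff lookup_add algebra_simps)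
  have "subgroup ?M (add_monoid ?A)"
  proof -
    have neg: "-m \<in> ?M" if "m \<in> ?M" for m
    proof -
      have "- m = Poly_Mapping.map ((*) (-1)) m"
        by (simp add: poly_mapping_eq_iff fun_eq_iff)
      with Ms[OF that] show ?thesis by simp
    qed
    show ?thesis
    proof (rule group.subgroupI[OF A.M.a_group])
      show "?M \<subseteq> carrier (add_monoid ?A)" using LTS_ideal_closed by auto
      show "?M \<noteq> {}" using M0 by auto
    next
      fix m assume m: "m \<in> ?M"
      have "inv\<^bsub>add_monoid ?A\<^esub> m = - m"
        using m neg[OF m] LTS_ideal_closed[of C]
        by (intro group.inv_equality[OF A.M.a_group]) auto
      with neg[OF m] show "inv\<^bsub>add_monoid ?A\<^esub> m \<in> ?M" by simp
    qed (use Ma in auto)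
  qed
  then have sub: "abelian_subgroup ?M ?A"
    by (intro abelian_subgroupI3 A.M.abelian_group_axioms) (simp add: additive_subgroup_def)
  have ag: "abelian_group (LTS C :: (_, ('c mag3 \<Rightarrow>\<^sub>0 'k) set) module)"
  proof -
    interpret Q: comm_group "?A A_Mod ?M"
      by (rule abelian_subgroup.a_factorgroup_is_comm_group[OF sub])
    have Q: "carrier (?A A_Mod ?M) = carrier (LTS C)" "mult (?A A_Mod ?M) = add (LTS C)"
      "one (?A A_Mod ?M) = zero (LTS C)"
      by (simp_all add: A_FactGroup_def FactGroup_def A_RCOSETS_def set_add_def)
    note q = Q.m_closed[unfolded Q] Q.one_closed[unfolded Q] Q.m_assoc[unfolded Q]
      Q.m_comm[unfolded Q] Q.l_one[unfolded Q] Q.l_inv_ex[unfolded Q]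
    show ?thesis
      by (rule abelian_groupI; (rule q; assumption))
  qed
  have carr: "X \<in> carrier (LTS C) \<longleftrightarrow> (\<exists>p\<in>carrier ?A. X = a_r_coset ?A ?M p)" for X
    by (auto simp: A_RCOSETS_def RCOSETS_def a_r_coset_def)
  have sm: "smult (LTS C) k (a_r_coset ?A ?M p) = a_r_coset ?A ?M (Poly_Mapping.map ((*) k) p)" for k p
  proof -
    have "(\<Union>r\<in>{m + p | m. m \<in> ?M}. {m + Poly_Mapping.map ((*) k) r | m. m \<in> ?M}) =
        {m + Poly_Mapping.map ((*) k) p | m. m \<in> ?M}" (is "?L = ?R")
    proof
      show "?L \<subseteq> ?R"
      proof clarify
        fix m m' assume "m \<in> ?M" "m' \<in> ?M"
        moreover have "m' + Poly_Mapping.map ((*) k) (m + p) =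
            (m' + Poly_Mapping.map ((*) k) m) + Poly_Mapping.map ((*) k) p"
          by (simp add: scale_diff add.assoc)
        ultimately show "\<exists>n. m' + Poly_Mapping.map ((*) k) (m + p) =
            n + Poly_Mapping.map ((*) k) p \<and> n \<in> ?M"
          using Ms Ma by blast
      qed
      show "?R \<subseteq> ?L"
      proof clarify
        fix m assume "m \<in> ?M"
        moreover have "p \<in> {m + p | m. m \<in> ?M}" using M0 by force
        ultimately show "m + Poly_Mapping.map ((*) k) p \<in> ?L" by blast
      qed
    qed
    then show ?thesis by (simp add: coset_eq)
  qed
  have ad: "set_add ?A (a_r_coset ?A ?M p) (a_r_coset ?A ?M q) = a_r_coset ?A ?M (p + q)"
    if "p \<in> carrier ?A" "q \<in> carrier ?A" for p q
    using abelian_subgroup.a_rcos_sum[OF sub that] by simp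
  have "module ?K (LTS C :: (_, ('c mag3 \<Rightarrow>\<^sub>0 'k) set) module)"
  proof (rule moduleI[OF class_cring.is_cring ag], goal_cases)
    case (1 k X)
    then obtain p where p: "p \<in> carrier ?A" "X = a_r_coset ?A ?M p" using carr by blast
    have "Poly_Mapping.map ((*) k) p \<in> carrier ?A"
      using p keys_scale[of k p] by auto
    then show ?case unfolding p(2) sm carr by blast
  next
    case (2 k l X)
    then obtain p where p: "p \<in> carrier ?A" "X = a_r_coset ?A ?M p" using carr by blast
    have "Poly_Mapping.map ((*) (k + l)) p = Poly_Mapping.map ((*) k) p + Poly_Mapping.map ((*) l) p"
      by (simp add: poly_mapping_eq_iff fun_eq_iff lookup_add algebra_simps)
    moreover have "Poly_Mapping.map ((*) i) p \<in> carrier ?A" for i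
      using p keys_scale[of i p] by auto
    ultimately show ?case using p sm ad by (simp del: LTS_simps(4) Alg3_simps(1))
  next
    case (3 k X Y)
    then obtain p q where p: "p \<in> carrier ?A" "X = a_r_coset ?A ?M p"
      and q: "q \<in> carrier ?A" "Y = a_r_coset ?A ?M q" using carr by meson
    have "Poly_Mapping.map ((*) k) r \<in> carrier ?A" if "r \<in> carrier ?A" for r
      using that keys_scale[of k r] by auto
    then show ?case using p q sm ad scale_diff by (simp del: LTS_simps(4) Alg3_simps(1))
  next
    case (4 k l X)
    then obtain p where p: "p \<in> carrier ?A" "X = a_r_coset ?A ?M p" using carr by blast
    have "Poly_Mapping.map ((*) (k * l)) p = Poly_Mapping.map ((*) k) (Poly_Mapping.map ((*) l) p)"
      by (simp add: poly_mapping_eq_iff fun_eq_iff algebra_simps)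
    then show ?case using p sm by (simp del: LTS_simps(4))
  next
    case (5 X)
    then obtain p where p: "p \<in> carrier ?A" "X = a_r_coset ?A ?M p" using carr by blast
    have "Poly_Mapping.map ((*) 1) p = p"
      by (simp add: poly_mapping_eq_iff fun_eq_iff)
    then show ?case using p sm by (simp del: LTS_simps(4))
  qed
  then show ?thesis by (simp add: vectorspace_def class_field.field_axioms)
qed

end

theory Submission
  imports Defs
begin

text \<open>
  Spanning is a rewriting argument in the quotient. For independence, \<open>[x,y,z] \<mapsto> [[x,y],z]\<close> maps
  \<open>Alg3 C\<close> to the free associative algebra and kills the ideal. There, consider products
  \<open>h\<^sub>1 \<dots> h\<^sub>k e\<^sub>1 \<dots> e\<^sub>m\<close> with Hall triples \<open>h\<^sub>1 \<le> \<dots> \<le> h\<^sub>k\<close> and commutators \<open>e\<^sub>i = [u,v]\<close>, where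
  \<open>u > v\<close> are Hall triples and \<open>u\<close> is a generator or has last entry at most \<open>v\<close>. Moving letters past smaller ones
  (\<open>x y = y x + [x,y]\<close>) writes each word as a combination of such products of the same multidegree.
  Keeping only the bracket at each step reconstructs a product from its underlying word, so there
  are no more products than words of each multidegree. Hence the products, in particular the
  Hall triples, are independent.
\<close>

section \<open>Linear algebra of finitely supported functions\<close>

abbreviation scl :: "'k::field \<Rightarrow> ('a \<Rightarrow>\<^sub>0 'k) \<Rightarrow> ('a \<Rightarrow>\<^sub>0 'k)" where
  "scl k \<equiv> Poly_Mapping.map ((*) k)"

abbreviation bv :: "'a \<Rightarrow> ('a \<Rightarrow>\<^sub>0 'k::field)" where
  "bv x \<equiv> Poly_Mapping.single x 1"

lemma lookup_scl: "Poly_Mapping.lookup (scl k p) t = k * Poly_Mapping.lookup p t"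
  by (simp add: Poly_Mapping.map.rep_eq when_def)

lemma scl_single: "scl k (Poly_Mapping.single t a) = Poly_Mapping.single t (k * a)"
  by (rule poly_mapping_eqI) (simp add: lookup_scl lookup_single when_def)

interpretation PM: vector_space "scl :: 'k::field \<Rightarrow> ('a \<Rightarrow>\<^sub>0 'k) \<Rightarrow> _"
  by standard (auto intro!: poly_mapping_eqI simp: lookup_scl lookup_add algebra_simps)

text \<open>The linear map with prescribed values \<open>f\<close> on the basis vectors.\<close>

definition lext :: "('a \<Rightarrow> ('b \<Rightarrow>\<^sub>0 'k::field)) \<Rightarrow> ('a \<Rightarrow>\<^sub>0 'k) \<Rightarrow> ('b \<Rightarrow>\<^sub>0 'k)" where
  "lext f p = (\<Sum>t\<in>Poly_Mapping.keys p. scl (Poly_Mapping.lookup p t) (f t))"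

lemma lext_superset:
  assumes "finite A" "Poly_Mapping.keys p \<subseteq> A"
  shows "lext f p = (\<Sum>t\<in>A. scl (Poly_Mapping.lookup p t) (f t))"
  unfolding lext_def using assms
  by (intro sum.mono_neutral_left) (auto simp: in_keys_iff)

lemma lext_add: "lext f (p + q) = lext f p + lext f q"
proof -
  let ?A = "Poly_Mapping.keys p \<union> Poly_Mapping.keys q"
  have "lext f r = (\<Sum>t\<in>?A. scl (Poly_Mapping.lookup r t) (f t))"
    if "Poly_Mapping.keys r \<subseteq> ?A" for r
    using that by (intro lext_superset) auto
  then show ?thesis
    using keys_add[of p q] by (simp add: lookup_add PM.scale_left_distrib sum.distrib)
qed

lemma lext_scl: "lext f (scl k p) = scl k (lext f p)"
proof -
  have "lext f (scl k p) = (\<Sum>t\<in>Poly_Mapping.keys p. scl (Poly_Mapping.lookup (scl k p) t) (f t))"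
    by (intro lext_superset) (auto simp: in_keys_iff lookup_scl)
  also have "\<dots> = scl k (lext f p)"
    by (simp add: lookup_scl lext_def PM.scale_sum_right)
  finally show ?thesis .
qed

lemma lext_single: "lext f (Poly_Mapping.single t a) = scl a (f t)"
  by (simp add: lext_def)

lemma lext_add_fun: "lext (\<lambda>t. f t + g t) p = lext f p + lext g p"
  by (simp add: lext_def PM.scale_right_distrib sum.distrib)

lemma lext_scl_fun: "lext (\<lambda>t. scl k (f t)) p = scl k (lext f p)"
  by (simp add: lext_def PM.scale_sum_right mult.commute)

lemma lext_sum: "lext f (sum g A) = (\<Sum>i\<in>A. lext f (g i))"
  by (induction A rule: infinite_finite_induct) (simp_all add: lext_add lext_def[of f 0])

lemma lext_diff: "lext f (p - q) = lext f p - lext f q"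
  by (metis add_diff_cancel_right' diff_add_cancel lext_add)

lemma lext_bv: "lext bv p = p"
proof (rule poly_mapping_eqI)
  fix t
  show "Poly_Mapping.lookup (lext bv p) t = Poly_Mapping.lookup p t"
    by (simp add: lext_def lookup_sum scl_single lookup_single when_def sum.delta in_keys_iff cong: if_cong)
qed

lemma keys_subset_iff_span:
  "Poly_Mapping.keys p \<subseteq> S \<longleftrightarrow> p \<in> PM.span (bv ` S)"
proof
  assume "Poly_Mapping.keys p \<subseteq> S"
  then have "lext bv p \<in> PM.span (bv ` S)"
    unfolding lext_def by (intro PM.span_sum PM.span_scale PM.span_base) auto
  then show "p \<in> PM.span (bv ` S)" by (simp add: lext_bv)
next
  have sub: "PM.subspace {p :: 'a \<Rightarrow>\<^sub>0 'b. Poly_Mapping.keys p \<subseteq> S}"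
    unfolding PM.subspace_def
  proof (intro conjI ballI allI CollectI; (elim CollectE)?)
    show "Poly_Mapping.keys (q + r) \<subseteq> S"
      if "Poly_Mapping.keys q \<subseteq> S" "Poly_Mapping.keys r \<subseteq> S" for q r :: "'a \<Rightarrow>\<^sub>0 'b"
      using that keys_add[of q r] by blast
    show "Poly_Mapping.keys (scl k q) \<subseteq> S"
      if "Poly_Mapping.keys q \<subseteq> S" for k and q :: "'a \<Rightarrow>\<^sub>0 'b"
      using that by (auto simp: in_keys_iff lookup_scl)
  qed simp
  assume "p \<in> PM.span (bv ` S)"
  then have "p \<in> {p. Poly_Mapping.keys p \<subseteq> S}"
    by (rule subsetD[OF PM.span_minimal[OF _ sub], rotated]) auto
  then show "Poly_Mapping.keys p \<subseteq> S" by simp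
qed

lemma independent_bv: "PM.independent (bv ` S :: ('a \<Rightarrow>\<^sub>0 'k::field) set)"
proof
  assume "PM.dependent (bv ` S :: ('a \<Rightarrow>\<^sub>0 'k) set)"
  then obtain x where x: "x \<in> S" "(bv x :: 'a \<Rightarrow>\<^sub>0 'k) \<in> PM.span (bv ` S - {bv x})"
    unfolding PM.dependent_def by auto
  have "bv ` S - {bv x} \<subseteq> (bv ` (S - {x}) :: ('a \<Rightarrow>\<^sub>0 'k) set)" by auto
  from PM.span_mono[OF this] x(2) have "(bv x :: 'a \<Rightarrow>\<^sub>0 'k) \<in> PM.span (bv ` (S - {x}))"
    by (rule subsetD)
  then have "Poly_Mapping.keys (bv x :: 'a \<Rightarrow>\<^sub>0 'k) \<subseteq> S - {x}"
    by (rule keys_subset_iff_span[THEN iffD2])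
  then show False by simp
qed

lemma inj_bv: "inj (bv :: 'a \<Rightarrow> ('a \<Rightarrow>\<^sub>0 'k::field))"
  by (rule injI, drule arg_cong[of _ _ Poly_Mapping.keys]) simp

section \<open>Trilinearity of the bracket\<close>

lemma br_lext: "br p q r = lext (\<lambda>x. lext (\<lambda>y. lext (\<lambda>z. bv (Br x y z)) r) q) p"
  unfolding br_def lext_def
  by (simp only: PM.scale_sum_right scl_single mult.assoc mult_1_right)

lemma br_add: "br (p + p') q r = br p q r + br p' q r"
  "br p (q + q') r = br p q r + br p q' r"
  "br p q (r + r') = br p q r + br p q r'"
  by (simp_all add: br_lext lext_add lext_add_fun)

lemma br_scl: "br (scl k p) q r = scl k (br p q r)"
  "br p (scl k q) r = scl k (br p q r)"
  "br p q (scl k r) = scl k (br p q r)"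
  by (simp_all add: br_lext lext_scl lext_scl_fun)

lemma br_zero [simp]: "br 0 q r = 0" "br p 0 r = 0" "br p q 0 = 0"
  by (simp_all add: br_def)

lemma br_bv [simp]: "br (bv x) (bv y) (bv z) = bv (Br x y z)"
  by (simp add: br_def)

lemma subspace_LTS_ideal: "PM.subspace (LTS_ideal C :: ('c mag3 \<Rightarrow>\<^sub>0 'k::field) set)"
  using ideal3_LTS_ideal[of C, where ?'k='k]
  unfolding ideal3_def subspace_Alg3_iff PM.subspace_def by blast

section \<open>The free associative algebra\<close>

text \<open>Words form a monoid under concatenation, which makes finitely supported functions on them
  the free associative algebra with the convolution product of \<^type>\<open>poly_mapping\<close>.\<close>

instantiation list :: (type) monoid_add
begin

definition zero_list :: "'a list" where "zero_list = []"
definition plus_list :: "'a list \<Rightarrow> 'a list \<Rightarrow> 'a list" where "plus_list = (@)"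

instance by standard (simp_all add: zero_list_def plus_list_def)

end

lemma scl_mult_left: "scl k p * q = scl k (p * (q :: 'a :: monoid_add \<Rightarrow>\<^sub>0 'k::field))"
  by (simp add: mult_map_scale_conv_mult mult.assoc)

text \<open>Scaling is left multiplication by \<open>single 0 k\<close>; the point is that this
  element acts in the same way from the right, which is checked on basis vectors.\<close>

lemma scl_mult_right: "p * scl k q = scl k (p * (q :: 'a :: monoid_add \<Rightarrow>\<^sub>0 'k::field))"
proof -
  have "p * Poly_Mapping.single 0 k = scl k p"
  proof -
    have "lext bv p * Poly_Mapping.single 0 k = scl k (lext bv p)"
      by (simp add: lext_def sum_distrib_right PM.scale_sum_right scl_single mult_single mult.commute)
    then show ?thesis by (simp add: lext_bv)
  qed
  then show ?thesis
    by (metis mult.assoc mult_map_scale_conv_mult scl_mult_left)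
qed

section \<open>Commutators and the map to the free associative algebra\<close>

definition commutator :: "'a::ring \<Rightarrow> 'a \<Rightarrow> 'a" where "commutator a b = a * b - b * a"

lemma commutator_scl: "commutator (scl k a) b = scl k (commutator a b)" "commutator a (scl k b) = scl k (commutator a b)"
  for a b :: "'a :: monoid_add \<Rightarrow>\<^sub>0 'k::field"
  by (simp_all add: commutator_def scl_mult_left scl_mult_right PM.scale_right_diff_distrib)

lemma commutator_sum: "commutator (sum f A) b = (\<Sum>i\<in>A. commutator (f i) b)" "commutator a (sum f A) = (\<Sum>i\<in>A. commutator a (f i))"
  by (simp_all add: commutator_def sum_distrib_left sum_distrib_right sum_subtractf)

lemma commutator_lext: "commutator (lext f p) b = lext (\<lambda>t. commutator (f t) b) p"
   "commutator a (lext f p) = lext (\<lambda>t. commutator a (f t)) p"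
  for a b :: "'a :: monoid_add \<Rightarrow>\<^sub>0 'k::field"
  by (simp_all add: lext_def commutator_sum commutator_scl)

lemma lext_lext: "lext f (lext g p) = lext (\<lambda>t. lext f (g t)) p"
  by (simp add: lext_def[of g] lext_def[of "\<lambda>t. lext f (g t)"] lext_sum lext_scl)

primrec lie :: "'c mag3 \<Rightarrow> ('c list \<Rightarrow>\<^sub>0 'k::field)" where
  "lie (Gen c) = bv [c]"
| "lie (Br a b c) = commutator (commutator (lie a) (lie b)) (lie c)"

lemma lext_lie_br:
  "lext lie (br p q r) = commutator (commutator (lext lie p) (lext lie q)) (lext lie r)"
proof -
  have "lext lie (br p q r) = lext (\<lambda>x. lext (\<lambda>y. lext (\<lambda>z. lie (Br x y z)) r) q) p"
    by (simp add: br_lext lext_lext lext_single)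
  also have "\<dots> = lext (\<lambda>x. lext (\<lambda>y. commutator (commutator (lie x) (lie y)) (lext lie r)) q) p"
    by (simp add: commutator_lext(2))
  also have "\<dots> = commutator (lext (\<lambda>x. lext (\<lambda>y. commutator (lie x) (lie y)) q) p) (lext lie r)"
    by (simp only: commutator_lext(1))
  also have "lext (\<lambda>x. lext (\<lambda>y. commutator (lie x) (lie y)) q) p = commutator (lext lie p) (lext lie q)"
    by (simp only: commutator_lext(1)) (simp only: commutator_lext(2))
  finally show ?thesis .
qed

text \<open>The vectors of the carrier killed by \<open>lext lie\<close> form an ideal. The double
  commutator satisfies antisymmetry, the Jacobi identity and the derivation rule, so this ideal
  contains the relators and hence the smallest ideal that does.\<close>

lemma LTS_ideal_lie:
  fixes p :: "'c mag3 \<Rightarrow>\<^sub>0 'k::field"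
  assumes "p \<in> LTS_ideal C" shows "lext lie p = 0"
proof -
  let ?K = "{p :: 'c mag3 \<Rightarrow>\<^sub>0 'k. p \<in> carrier (Alg3 C) \<and> lext lie p = 0}"
  have sub: "subspace (class_ring :: 'k ring) ?K (Alg3 C)"
    using ideal3_Alg3[of C, where ?'k='k]
    unfolding ideal3_def subspace_Alg3_iff
    by (simp add: lext_add lext_scl lext_def[of lie 0] subset_iff del: Alg3_simps(1))
  have "br m p q \<in> ?K \<and> br p m q \<in> ?K \<and> br p q m \<in> ?K"
    if "m \<in> ?K" "p \<in> carrier (Alg3 C)" "q \<in> carrier (Alg3 C)" for m p q :: "'c mag3 \<Rightarrow>\<^sub>0 'k"
    using that by (simp add: br_closed lext_lie_br commutator_def del: Alg3_simps(1))
  with sub have "ideal3 C ?K"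
    unfolding ideal3_def by blast
  moreover have "LTS_relators C \<subseteq> ?K"
  proof
    fix p :: "'c mag3 \<Rightarrow>\<^sub>0 'k" assume p: "p \<in> LTS_relators C"
    then have "lext lie p = 0"
      unfolding LTS_relators_def
      by (elim UnE CollectE exE conjE) (simp_all add: lext_add lext_diff lext_lie_br commutator_def, simp_all add: algebra_simps)
    with p relators_closed show "p \<in> ?K" by blast
  qed
  ultimately have "LTS_ideal C \<subseteq> ?K"
    unfolding LTS_ideal_def by (intro hull_minimal)
  with assms show ?thesis by blast
qed

section \<open>Hall triples span\<close>

locale hall_triples =
  fixes C :: "'c set" and H :: "'c mag3 set" and lt :: "'c mag3 \<Rightarrow> 'c mag3 \<Rightarrow> bool"
  assumes hall: "hall_triple_set C H lt"
begin

abbreviation le :: "'c mag3 \<Rightarrow> 'c mag3 \<Rightarrow> bool" where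
  "le u v \<equiv> u = v \<or> lt u v"

lemma H_Mag3: "H \<subseteq> Mag3 C" and Gen_H: "c \<in> C \<Longrightarrow> Gen c \<in> H"
  using hall unfolding hall_triple_set_def by auto

lemma lt_irrefl: "u \<in> H \<Longrightarrow> \<not> lt u u"
  and lt_trans: "lt u v \<Longrightarrow> lt v w \<Longrightarrow> u \<in> H \<Longrightarrow> v \<in> H \<Longrightarrow> w \<in> H \<Longrightarrow> lt u w"
  and lt_total: "u \<in> H \<Longrightarrow> v \<in> H \<Longrightarrow> u \<noteq> v \<Longrightarrow> lt u v \<or> lt v u"
proof -
  have "irreflp_on H lt" "transp_on H lt" "totalp_on H lt"
    using hall by (simp_all add: hall_triple_set_def)
  note order = irreflp_onD[OF this(1)] transp_onD[OF this(2)] totalp_onD[OF this(3)]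
  show "u \<in> H \<Longrightarrow> \<not> lt u u" by (rule order(1))
  show "lt u v \<Longrightarrow> lt v w \<Longrightarrow> u \<in> H \<Longrightarrow> v \<in> H \<Longrightarrow> w \<in> H \<Longrightarrow> lt u w" by (rule order(2))
  show "u \<in> H \<Longrightarrow> v \<in> H \<Longrightarrow> u \<noteq> v \<Longrightarrow> lt u v \<or> lt v u" by (rule order(3))
qed

lemma lt_asym: "lt u v \<Longrightarrow> u \<in> H \<Longrightarrow> v \<in> H \<Longrightarrow> \<not> lt v u"
  using lt_irrefl lt_trans by blast

lemma deg_lt: "deg u < deg v \<Longrightarrow> u \<in> H \<Longrightarrow> v \<in> H \<Longrightarrow> lt u v"
  using hall unfolding hall_triple_set_def by blast

lemma deg_pos: "0 < deg t"
  by (induction t) auto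

lemma Br_H: "Br u v w \<in> H \<longleftrightarrow> u \<in> H \<and> v \<in> H \<and> w \<in> H \<and> lt v u \<and> le v w \<and>
    ((\<exists>c\<in>C. u = Gen c) \<or> (\<exists>a b c. u = Br a b c \<and> le c v))"
  using hall unfolding hall_triple_set_def by blast

lemma H_cases:
  assumes "u \<in> H"
  obtains c where "c \<in> C" "u = Gen c" | a b c where "u = Br a b c"
  using assms H_Mag3 by (cases u) (auto simp: Mag3_def)

section \<open>Spans modulo the ideal of relations\<close>

abbreviation M :: "('c mag3 \<Rightarrow>\<^sub>0 'k::field) set" where "M \<equiv> LTS_ideal C"

text \<open>Adjoining \<open>M\<close> to the generators turns congruence modulo the ideal into span
  membership, so the rewriting can take place in \<open>Alg3 C\<close> itself.\<close>

abbreviation aspan :: "'c mag3 set \<Rightarrow> ('c mag3 \<Rightarrow>\<^sub>0 'k::field) set" where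
  "aspan A \<equiv> PM.span (bv ` A \<union> M)"

lemma aspan_carrier:
  assumes "A \<subseteq> Mag3 C" shows "(aspan A :: ('c mag3 \<Rightarrow>\<^sub>0 'k::field) set) \<subseteq> carrier (Alg3 C)"
proof (rule PM.span_minimal)
  show "bv ` A \<union> M \<subseteq> carrier (Alg3 C :: ('k, 'c mag3 \<Rightarrow>\<^sub>0 'k) module)"
    using assms LTS_ideal_closed by auto
  show "PM.subspace (carrier (Alg3 C :: ('k, 'c mag3 \<Rightarrow>\<^sub>0 'k) module))"
    using ideal3_Alg3[of C, where ?'k='k]
    unfolding ideal3_def subspace_Alg3_iff PM.subspace_def by blast
qed

lemma M_aspan: "m \<in> M \<Longrightarrow> m \<in> aspan A"
  by (rule PM.span_base) simp

lemma bv_aspan: "a \<in> A \<Longrightarrow> bv a \<in> aspan A"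
  by (rule PM.span_base) simp

lemma M_br:
  assumes "m \<in> M" "p \<in> carrier (Alg3 C)" "q \<in> carrier (Alg3 C)"
  shows "br m p q \<in> M" "br p m q \<in> M" "br p q m \<in> M"
  using assms ideal3_LTS_ideal unfolding ideal3_def by blast+

text \<open>The bracket is trilinear, and a bracket with an entry in \<open>M\<close> lies in
  \<open>M\<close>. Reducing the entries one at a time to basis vectors therefore leaves only
  \<open>ABD\<close>.\<close>

lemma aspan_br:
  fixes T :: "('c mag3 \<Rightarrow>\<^sub>0 'k::field) set"
  assumes sub: "A \<subseteq> H" "B \<subseteq> H" "D \<subseteq> H"
    and T: "PM.subspace T" "M \<subseteq> T"
    and ABD: "\<And>a b d. a \<in> A \<Longrightarrow> b \<in> B \<Longrightarrow> d \<in> D \<Longrightarrow> bv (Br a b d) \<in> T"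
    and p: "p \<in> aspan A" and q: "q \<in> aspan B" and r: "r \<in> aspan D"
  shows "br p q r \<in> T"
proof -
  have sub': "A \<subseteq> Mag3 C" "B \<subseteq> Mag3 C" "D \<subseteq> Mag3 C"
    using sub H_Mag3 by auto
  have cl: "p \<in> carrier (Alg3 C)" "q \<in> carrier (Alg3 C)" "r \<in> carrier (Alg3 C)"
    using p q r aspan_carrier[OF sub'(1), where 'k='k] aspan_carrier[OF sub'(2), where 'k='k]
      aspan_carrier[OF sub'(3), where 'k='k] by blast+
  have bvcl: "bv x \<in> carrier (Alg3 C :: ('k, 'c mag3 \<Rightarrow>\<^sub>0 'k) module)" if "x \<in> Mag3 C" for x
    using that by simp
  have Aat: "aspan X \<subseteq> {x. f x \<in> T}"
    if "PM.subspace {x. f x \<in> T}" "\<And>a. a \<in> X \<Longrightarrow> f (bv a) \<in> T" "\<And>m. m \<in> M \<Longrightarrow> f m \<in> M" for X and f :: "_ \<Rightarrow> 'c mag3 \<Rightarrow>\<^sub>0 'k"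
    using that T(2) by (intro PM.span_minimal) auto
  note T' = PM.subspace_0[OF T(1)] PM.subspace_add[OF T(1)] PM.subspace_scale[OF T(1)]
  have subsp: "PM.subspace {x. br x y z \<in> T}" "PM.subspace {x. br y x z \<in> T}"
    "PM.subspace {x. br y z x \<in> T}" for y z
    unfolding PM.subspace_def by (auto simp: br_add br_scl T')
  have 1: "br (bv a) (bv b) r \<in> T" if "a \<in> A" "b \<in> B" for a b
  proof -
    have "aspan D \<subseteq> {x. br (bv a) (bv b) x \<in> T}"
      using that sub' by (intro Aat subsp M_br bvcl) (auto simp: ABD)
    with r show ?thesis by blast
  qed
  have 2: "br (bv a) q r \<in> T" if "a \<in> A" for a
  proof -
    have "aspan B \<subseteq> {x. br (bv a) x r \<in> T}"
      using that sub' by (intro Aat subsp M_br bvcl cl) (auto simp: 1)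
    with q show ?thesis by blast
  qed
  have "aspan A \<subseteq> {x. br x q r \<in> T}"
    using sub' by (intro Aat subsp M_br cl) (auto simp: 2)
  with p show ?thesis by blast
qed

lemma relators:
  fixes x y z u v :: "'c mag3 \<Rightarrow>\<^sub>0 'k::field"
  assumes "x \<in> carrier (Alg3 C)" "y \<in> carrier (Alg3 C)" "z \<in> carrier (Alg3 C)"
  shows "br x y z + br y x z \<in> M"
    and "br x y z + br y z x + br z x y \<in> M"
    and "\<lbrakk>u \<in> carrier (Alg3 C); v \<in> carrier (Alg3 C)\<rbrakk> \<Longrightarrow>
      br u v (br x y z) - (br (br u v x) y z + br x (br u v y) z + br x y (br u v z)) \<in> M"
proof -
  have rel: "LTS_relators C \<subseteq> (M :: ('c mag3 \<Rightarrow>\<^sub>0 'k) set)"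
    unfolding LTS_ideal_def by (rule hull_subset)
  show "br x y z + br y x z \<in> M"
    using assms by (intro subsetD[OF rel]) (unfold LTS_relators_def, blast)
  show "br x y z + br y z x + br z x y \<in> M"
    using assms by (intro subsetD[OF rel]) (unfold LTS_relators_def, blast)
  show "br u v (br x y z) - (br (br u v x) y z + br x (br u v y) z + br x y (br u v z)) \<in> M"
    if "u \<in> carrier (Alg3 C)" "v \<in> carrier (Alg3 C)"
    using assms that by (intro subsetD[OF rel]) (unfold LTS_relators_def, blast)
qed

text \<open>Relation (2) is what makes this hold in characteristic 2, where (1) alone does not give it.\<close>

lemma br_same:
  fixes x z :: "'c mag3 \<Rightarrow>\<^sub>0 'k::field"
  assumes "x \<in> carrier (Alg3 C)" "z \<in> carrier (Alg3 C)"
  shows "br x x z \<in> M"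
proof -
  have "br x x z = (br x x z + br x z x + br z x x) - (br x z x + br z x x)" by simp
  also have "\<dots> \<in> M"
    using assms by (intro PM.subspace_diff[OF subspace_LTS_ideal] relators)
  finally show ?thesis .
qed

text \<open>Meant for finite \<open>G\<close>: then there are only finitely many Hall triples of
  bounded degree, so an induction that climbs in the order terminates.\<close>

definition Hd :: "'c set \<Rightarrow> nat \<Rightarrow> 'c mag3 set" where
  "Hd G d = {h \<in> H. gens h \<subseteq> G \<and> deg h = d}"

lemma finite_mag3_deg: "finite G \<Longrightarrow> finite {t :: 'c mag3. gens t \<subseteq> G \<and> deg t \<le> d}"
proof (induction d)
  case 0
  then show ?case by (simp add: deg_pos[THEN gr_implies_not0])
next
  case (Suc d)
  let ?S = "{t :: 'c mag3. gens t \<subseteq> G \<and> deg t \<le> d}"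
  have "{t :: 'c mag3. gens t \<subseteq> G \<and> deg t \<le> Suc d} \<subseteq>
      Gen ` G \<union> (\<lambda>(a, b, c). Br a b c) ` (?S \<times> ?S \<times> ?S)"
  proof
    fix t :: "'c mag3" assume t: "t \<in> {t. gens t \<subseteq> G \<and> deg t \<le> Suc d}"
    show "t \<in> Gen ` G \<union> (\<lambda>(a, b, c). Br a b c) ` (?S \<times> ?S \<times> ?S)"
    proof (cases t)
      case (Br a b c)
      then have "a \<in> ?S" "b \<in> ?S" "c \<in> ?S"
        using t deg_pos[of a] deg_pos[of b] deg_pos[of c] by auto
      then show ?thesis using Br by (intro UnI2 image_eqI[of _ _ "(a, b, c)"]) simp_all
    qed (use t in auto)
  qed
  then show ?case by (rule finite_subset) (use Suc in auto)
qed

text \<open>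
  Induction on the total degree, then on \<open>w\<close> upwards, then on \<open>min u v\<close> upwards, in the finite set of
  Hall triples of bounded degree over \<open>G\<close>. The two reductions are
  \<open>[u,v,w] = [u,w,v] - [v,w,u]\<close> for \<open>w < v\<close> and
  \<open>[[a,b,c],v,w] = [a,b,[c,v,w]] - [c,[a,b,v],w] - [c,v,[a,b,w]]\<close> for \<open>v < c\<close>; since the order
  refines the degree, expanding an inner bracket only produces Hall triples above its entries.
\<close>

lemma Br_aspan:
  assumes "finite G" "u \<in> H" "v \<in> H" "w \<in> H"
    "gens u \<subseteq> G" "gens v \<subseteq> G" "gens w \<subseteq> G" "deg u + deg v + deg w = d"
  shows "(bv (Br u v w) :: 'c mag3 \<Rightarrow>\<^sub>0 'k::field) \<in> aspan (Hd G d)"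
  using assms(2-)
proof (induction d arbitrary: u v w rule: less_induct)
  case (less d)
  note IHd = less.IH
  define HG where "HG = {h \<in> H. gens h \<subseteq> G}"
  define T where "T = (aspan (Hd G d) :: ('c mag3 \<Rightarrow>\<^sub>0 'k) set)"
  have T: "PM.subspace T" "M \<subseteq> T"
    unfolding T_def using M_aspan by (auto intro: PM.subspace_span)
  \<comment> \<open>Counts the Hall triples of degree at most \<open>d\<close> above
    \<open>k\<close>. It falls as \<open>k\<close> rises, which turns upward induction into
    induction on a natural number.\<close>
  define N where "N k = card {h \<in> HG. deg h \<le> d \<and> lt k h}" for k
  have N_less: "N k' < N k" if "k \<in> HG" "k' \<in> HG" "deg k' \<le> d" "lt k k'" for k k'
  proof -
    have "finite {h \<in> HG. deg h \<le> d \<and> lt k h}"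
      by (rule finite_subset[OF _ finite_mag3_deg[OF \<open>finite G\<close>, of d]]) (auto simp: HG_def)
    moreover have "{h \<in> HG. deg h \<le> d \<and> lt k' h} \<subset> {h \<in> HG. deg h \<le> d \<and> lt k h}"
    proof (rule psubsetI)
      show "{h \<in> HG. deg h \<le> d \<and> lt k' h} \<subseteq> {h \<in> HG. deg h \<le> d \<and> lt k h}"
        using that by (auto simp: HG_def intro: lt_trans[of k k'])
      show "{h \<in> HG. deg h \<le> d \<and> lt k' h} \<noteq> {h \<in> HG. deg h \<le> d \<and> lt k h}"
        using that lt_irrefl[of k'] by (auto simp: HG_def)
    qed
    ultimately show ?thesis unfolding N_def by (rule psubset_card_mono)
  qed
  have HGc: "bv x \<in> carrier (Alg3 C :: ('k, 'c mag3 \<Rightarrow>\<^sub>0 'k) module)" if "x \<in> HG" for x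
    using that H_Mag3 by (auto simp: HG_def)
  have Hd_HG: "h \<in> HG" "deg h = d'" if "h \<in> Hd G d'" for h d'
    using that by (auto simp: Hd_def HG_def)
  have IHd: "(bv (Br u v w) :: 'c mag3 \<Rightarrow>\<^sub>0 'k) \<in> aspan (Hd G (deg u + deg v + deg w))"
    if "u \<in> HG" "v \<in> HG" "w \<in> HG" "deg u + deg v + deg w < d" for u v w
    using that IHd[of "deg u + deg v + deg w" u v w] unfolding HG_def by simp
  have subH: "Hd G d' \<subseteq> H" "x \<in> HG \<Longrightarrow> {x} \<subseteq> H" for d' x
    by (auto simp: Hd_def HG_def)
  have claim: "bv (Br u v w) \<in> T"
    if "u \<in> HG" "v \<in> HG" "w \<in> HG" "deg u + deg v + deg w = d" for u v w
    using that
  proof (induction "N w" arbitrary: u v w rule: less_induct)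
    case less
    have w: "w \<in> HG" by (rule less.prems)
    have IHw: "bv (Br u v w') \<in> T"
      if "lt w w'" "u \<in> HG" "v \<in> HG" "w' \<in> HG" "deg u + deg v + deg w' = d" for u v w'
      using that less.hyps[of w' u v] N_less[of w w'] w by simp
    have swap: "bv (Br u v k) \<in> T" if "bv (Br v u k) \<in> T" "u \<in> HG" "v \<in> HG" "k \<in> HG" for u v k
    proof -
      have "bv (Br u v k) = (br (bv u) (bv v) (bv k) + br (bv v) (bv u) (bv k)) - bv (Br v u k)"
        by simp
      also have "\<dots> \<in> T"
        using T that HGc by (intro PM.subspace_diff[OF T(1)] subsetD[OF T(2) relators(1)]) auto
      finally show ?thesis .
    qed
    \<comment> \<open>The smaller of the first two entries is put second; the other cases follow by
      \<open>swap\<close> and \<open>br_same\<close>.\<close>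
    have main: "bv (Br u v w) \<in> T" if "lt v u" "u \<in> HG" "v \<in> HG" "deg u + deg v + deg w = d" for u v
      using that
    proof (induction "N v" arbitrary: u v rule: less_induct)
      case less
      have v: "v \<in> HG" and u: "u \<in> HG" and d: "deg u + deg v + deg w = d" by (rule less.prems)+
      have IHv: "bv (Br u v' w) \<in> T"
        if "lt v v'" "lt v' u" "u \<in> HG" "v' \<in> HG" "deg u + deg v' + deg w = d" for u v'
        using that less.hyps[of v' u] N_less[of v v'] v by simp
      \<comment> \<open>Given \<open>v < u\<close>, the bracket fails to be a Hall triple only
        through \<open>w < v\<close> or, for \<open>u = [a,b,c]\<close>, through
        \<open>v < c\<close>.\<close>
      consider "lt w v" | "le v w" "Br u v w \<in> H" | a b c where "u = Br a b c" "lt c v = False" "c \<noteq> v" "le v w"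
        using lt_total[of v w] u v w Br_H[of u v w] less.prems(1) H_cases[of u]
        by (smt (verit) HG_def mem_Collect_eq)
      then show ?case
      proof cases
        case 1
        have "lt w u" using 1 less.prems(1) lt_trans[of w v u] u v w by (simp add: HG_def)
        \<comment> \<open>The two other terms of the cyclic relation end in \<open>u\<close> and
          \<open>v\<close>, both above \<open>w\<close>, so \<open>IHw\<close> covers them.\<close>
        let ?J = "br (bv u) (bv v) (bv w) + br (bv v) (bv w) (bv u) + br (bv w) (bv u) (bv v)"
        have "bv (Br u v w) = ?J - (bv (Br v w u) + bv (Br w u v))" by simp
        also have "\<dots> \<in> T"
        proof (rule PM.subspace_diff[OF T(1) _ PM.subspace_add[OF T(1)]])
          show "?J \<in> T" using HGc u v w by (intro subsetD[OF T(2) relators(2)])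
          show "bv (Br v w u) \<in> T" "bv (Br w u v) \<in> T"
            using IHw \<open>lt w u\<close> 1 u v w d by (auto simp: ac_simps)
        qed
        finally show ?thesis .
      next
        case 2
        then show ?thesis
          using u v w d unfolding T_def by (intro bv_aspan) (auto simp: Hd_def HG_def)
      next
        case (3 a b c)
        have abc: "a \<in> HG" "b \<in> HG" "c \<in> HG"
          using u unfolding 3 HG_def by (auto simp: Br_H)
        have vc: "lt v c" using 3 lt_total[of v c] abc v unfolding HG_def by auto
        note dp = deg_pos[of a] deg_pos[of b] deg_pos[of c] deg_pos[of v] deg_pos[of w]
        have d': "deg a + deg b + deg c + deg v + deg w = d" using d 3 by simp
        let ?b = "bv :: 'c mag3 \<Rightarrow> _ \<Rightarrow>\<^sub>0 'k"
        let ?R = "br (?b a) (?b b) (br (?b c) (?b v) (?b w)) -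
          (br (br (?b a) (?b b) (?b c)) (?b v) (?b w) + br (?b c) (br (?b a) (?b b) (?b v)) (?b w)
           + br (?b c) (?b v) (br (?b a) (?b b) (?b w)))"
        \<comment> \<open>The inner bracket has total degree below \<open>d\<close>, so it expands
          into Hall triples. Their degree exceeds that of \<open>w\<close>, so every new last entry
          is above \<open>w\<close>. The term \<open>2\<close> is treated in the same way.\<close>
        have 1: "br (?b a) (?b b) (?b (Br c v w)) \<in> T"
        proof (rule aspan_br[OF subH(2) subH(2) subH(1) T, OF abc(1) abc(2)])
          show "bv (Br x y h) \<in> T" if "x \<in> {a}" "y \<in> {b}" "h \<in> Hd G (deg c + deg v + deg w)" for x y h
            using that Hd_HG[OF that(3)] abc w d' dp by (auto intro!: IHw deg_lt simp: HG_def)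
          show "?b (Br c v w) \<in> aspan (Hd G (deg c + deg v + deg w))"
            using abc v w d' dp by (intro IHd) auto
        qed (auto intro: PM.span_base)
        have 2: "br (?b c) (?b v) (?b (Br a b w)) \<in> T"
        proof (rule aspan_br[OF subH(2) subH(2) subH(1) T, OF abc(3) v])
          show "bv (Br x y h) \<in> T" if "x \<in> {c}" "y \<in> {v}" "h \<in> Hd G (deg a + deg b + deg w)" for x y h
            using that Hd_HG[OF that(3)] abc v w d' dp by (auto intro!: IHw deg_lt simp: HG_def)
          show "?b (Br a b w) \<in> aspan (Hd G (deg a + deg b + deg w))"
            using abc v w d' dp by (intro IHd) auto
        qed (auto intro: PM.span_base)
        \<comment> \<open>Here the last entry stays \<open>w\<close>. Every \<open>h\<close> coming
          from \<open>[a,b,v]\<close> has larger degree than \<open>v\<close>, and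
          \<open>v < c\<close>, so the smaller of \<open>c\<close> and \<open>h\<close> is above
          \<open>v\<close> and \<open>IHv\<close> applies; \<open>h = c\<close> gives an element of
          \<open>M\<close>.\<close>
        have r3: "br (?b c) (?b (Br a b v)) (?b w) \<in> T"
        proof (rule aspan_br[OF subH(2) subH(1) subH(2) T, OF abc(3) w])
          show "bv (Br x h z) \<in> T" if that: "x \<in> {c}" "h \<in> Hd G (deg a + deg b + deg v)" "z \<in> {w}" for x h z
          proof -
            have h: "h \<in> HG" "deg h = deg a + deg b + deg v" by (fact Hd_HG[OF that(2)])+
            have vh: "lt v h" using h v dp by (auto intro!: deg_lt simp: HG_def)
            have "h = c \<or> lt h c \<or> lt c h" using lt_total h abc unfolding HG_def by auto
            then have "bv (Br c h w) \<in> T"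
            proof (elim disjE)
              assume "h = c"
              then show ?thesis
                using br_same[OF HGc HGc, OF abc(3) w] T(2) by auto
            next
              assume "lt h c"
              then show ?thesis using IHv[OF vh] h abc d' by simp
            next
              assume "lt c h"
              then have "bv (Br h c w) \<in> T" using IHv[OF vc] h abc d' by simp
              then show ?thesis by (rule swap) (use h abc w in auto)
            qed
            with that show ?thesis by simp
          qed
          show "?b (Br a b v) \<in> aspan (Hd G (deg a + deg b + deg v))"
            using abc v w d' dp by (intro IHd) auto
        qed (auto intro: PM.span_base)
        have R: "?R \<in> T"
          using HGc abc v w by (intro subsetD[OF T(2) relators(3)])
        have "bv (Br u v w) = br (?b a) (?b b) (?b (Br c v w)) - br (?b c) (?b (Br a b v)) (?b w)
            - br (?b c) (?b v) (?b (Br a b w)) - ?R"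
          unfolding 3 by simp
        also have "\<dots> \<in> T"
          by (rule PM.subspace_diff[OF T(1) PM.subspace_diff[OF T(1) PM.subspace_diff[OF T(1) 1 r3] 2] R])
        finally show ?thesis .
      qed
    qed
    have "u = v \<or> lt v u \<or> lt u v" using lt_total less.prems unfolding HG_def by auto
    then show ?case
    proof (elim disjE)
      assume "u = v"
      then show ?thesis
        using br_same[OF HGc HGc, of v w] less.prems T(2) by auto
    next
      assume "lt v u"
      then show ?thesis using main[of v u] less.prems by simp
    next
      assume "lt u v"
      then have "bv (Br v u w) \<in> T" using main[of u v] less.prems by (simp add: ac_simps)
      then show ?thesis by (rule swap) (use less.prems in auto)
    qed
  qed
  show ?case using claim[of u v w] less.prems unfolding T_def HG_def by simp
qed

text \<open>Expanding the three entries by the induction hypothesis leaves brackets of Hall triples,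
  which \<open>Br_aspan\<close> rewrites.\<close>

lemma bv_aspan_Hd:
  assumes "finite G" "G \<subseteq> C" "gens t \<subseteq> G"
  shows "(bv t :: 'c mag3 \<Rightarrow>\<^sub>0 'k::field) \<in> aspan (Hd G (deg t))"
  using assms(3)
proof (induction t)
  case (Gen c)
  then show ?case using assms Gen_H by (intro bv_aspan) (auto simp: Hd_def)
next
  case (Br a b c)
  have sub: "Hd G d \<subseteq> H" for d by (auto simp: Hd_def)
  have "br (bv a) (bv b) (bv c) \<in> (aspan (Hd G (deg (Br a b c))) :: ('c mag3 \<Rightarrow>\<^sub>0 'k) set)"
  proof (rule aspan_br[OF sub sub sub PM.subspace_span])
    show "bv (Br x y z) \<in> aspan (Hd G (deg (Br a b c)))"
      if "x \<in> Hd G (deg a)" "y \<in> Hd G (deg b)" "z \<in> Hd G (deg c)" for x y z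
      using that \<open>finite G\<close> by (intro Br_aspan) (auto simp: Hd_def)
    show "M \<subseteq> aspan (Hd G (deg (Br a b c)))" using M_aspan by blast
  qed (use Br in auto)
  then show ?case by simp
qed

lemma carrier_aspan: "carrier (Alg3 C) \<subseteq> (aspan H :: ('c mag3 \<Rightarrow>\<^sub>0 'k::field) set)"
proof
  fix p :: "'c mag3 \<Rightarrow>\<^sub>0 'k" assume "p \<in> carrier (Alg3 C)"
  then have p: "p \<in> PM.span (bv ` Mag3 C)"
    by (simp add: keys_subset_iff_span)
  have "bv t \<in> (aspan H :: ('c mag3 \<Rightarrow>\<^sub>0 'k) set)" if "t \<in> Mag3 C" for t
  proof -
    have "finite (gens t)" by (induction t) auto
    then have "bv t \<in> (aspan (Hd (gens t) (deg t)) :: ('c mag3 \<Rightarrow>\<^sub>0 'k) set)"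
      using that by (intro bv_aspan_Hd) (auto simp: Mag3_def)
    then show ?thesis
      by (rule subsetD[OF PM.span_mono, rotated]) (auto simp: Hd_def)
  qed
  then have "PM.span (bv ` Mag3 C) \<subseteq> (aspan H :: ('c mag3 \<Rightarrow>\<^sub>0 'k) set)"
    by (intro PM.span_minimal PM.subspace_span) auto
  with p show "p \<in> aspan H" by blast
qed

end

section \<open>Hall triples are independent\<close>

text \<open>\<open>Even u v\<close> stands for the commutator of \<open>u\<close> and \<open>v\<close>.\<close>

datatype 'c letter = Odd "'c mag3" | Even "'c mag3" "'c mag3"

primrec word :: "'c mag3 \<Rightarrow> 'c list" where
  "word (Gen c) = [c]"
| "word (Br a b c) = word a @ word b @ word c"

primrec lword :: "'c letter \<Rightarrow> 'c list" where
  "lword (Odd u) = word u"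
| "lword (Even u v) = word u @ word v"

definition words :: "'c letter list \<Rightarrow> 'c list" where
  "words n = concat (map lword n)"

lemma words_simps [simp]: "words [] = []" "words (x # n) = lword x @ words n"
  by (simp_all add: words_def)

primrec val :: "'c letter \<Rightarrow> ('c list \<Rightarrow>\<^sub>0 'k::field)" where
  "val (Odd u) = lie u"
| "val (Even u v) = commutator (lie u) (lie v)"

definition vals :: "'c letter list \<Rightarrow> ('c list \<Rightarrow>\<^sub>0 'k::field)" where
  "vals n = prod_list (map val n)"

lemma vals_simps [simp]: "vals [] = 1" "vals (x # n) = val x * vals n"
  by (simp_all add: vals_def)

primrec bracket :: "'c letter \<Rightarrow> 'c mag3 \<Rightarrow> 'c letter" where
  "bracket (Odd u) y = Even u y"
| "bracket (Even u v) y = Odd (Br u v y)"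

lemma lword_bracket [simp]: "lword (bracket x y) = lword x @ word y"
  by (cases x) simp_all

lemma val_bracket: "val (bracket x y) = commutator (val x) (lie y)"
  by (cases x) simp_all

definition odds :: "'c letter list \<Rightarrow> 'c mag3 set" where
  "odds n = {y. Odd y \<in> set n}"

lemma odds_simps [simp]: "odds [] = {}" "odds (Odd y # n) = insert y (odds n)"
  "odds (Even u v # n) = odds n"
  by (auto simp: odds_def)

section \<open>Normal lists of letters and insertion\<close>

context hall_triples
begin

text \<open>Compares \<open>y\<close> with the last entry of the letter, a generator imposing no
  condition. For a letter that exceeds \<open>y\<close>, this is what makes
  \<open>bracket x y\<close> a letter again.\<close>

fun above :: "'c letter \<Rightarrow> 'c mag3 \<Rightarrow> bool" where
  "above (Odd (Gen _)) y \<longleftrightarrow> True"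
| "above (Odd (Br _ _ c)) y \<longleftrightarrow> le c y"
| "above (Even _ v) y \<longleftrightarrow> le v y"

text \<open>Decides whether an odd letter \<open>y\<close> to the right has to be moved to the left
  past this letter. Even letters always give way, so odd letters end up in front.\<close>

primrec exceeds :: "'c letter \<Rightarrow> 'c mag3 \<Rightarrow> bool" where
  "exceeds (Odd u) y \<longleftrightarrow> lt y u"
| "exceeds (Even _ _) y \<longleftrightarrow> True"

definition letters :: "'c letter set" where
  "letters = Odd ` H \<union> {Even u v | u v. u \<in> H \<and> v \<in> H \<and> lt v u \<and> above (Odd u) v}"

lemma letters_simps [simp]:
  "Odd u \<in> letters \<longleftrightarrow> u \<in> H"
  "Even u v \<in> letters \<longleftrightarrow> u \<in> H \<and> v \<in> H \<and> lt v u \<and> above (Odd u) v"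
  by (auto simp: letters_def)

text \<open>Since an even letter exceeds everything, no odd letter follows an even one: these lists
  are weakly increasing Hall triples followed by even letters in any order, much like PBW
  monomials.\<close>

primrec normal :: "'c letter list \<Rightarrow> bool" where
  "normal [] \<longleftrightarrow> True"
| "normal (x # n) \<longleftrightarrow> x \<in> letters \<and> normal n \<and> (\<forall>y\<in>odds n. above x y \<and> \<not> exceeds x y)"

lemma normal_odds: "normal n \<Longrightarrow> odds n \<subseteq> H"
proof (induction n)
  case (Cons x n)
  then show ?case by (cases x) auto
qed simp

text \<open>The shadow of \<open>x y = y x + [x,y]\<close> in which only the bracket survives; the
  underlying word does not change.\<close>

fun ins :: "'c letter \<Rightarrow> 'c letter list \<Rightarrow> 'c letter list" where
  "ins x (Odd y # n) = (if exceeds x y then ins (bracket x y) n else x # Odd y # n)"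
| "ins x n = x # n"

lemma ins_eq_Cons: "\<forall>y\<in>odds n. \<not> exceeds x y \<Longrightarrow> ins x n = x # n"
  by (cases "(x, n)" rule: ins.cases) auto

lemma above_Br_H:
  "Br u v w \<in> H \<longleftrightarrow> u \<in> H \<and> v \<in> H \<and> w \<in> H \<and> lt v u \<and> le v w \<and> above (Odd u) v"
proof -
  have "above (Odd u) v \<longleftrightarrow> (\<exists>c\<in>C. u = Gen c) \<or> (\<exists>a b c. u = Br a b c \<and> le c v)" if "u \<in> H"
    using that by (cases u rule: H_cases) auto
  then show ?thesis unfolding Br_H by blast
qed

lemma le_trans: "le u v \<Longrightarrow> le v w \<Longrightarrow> u \<in> H \<Longrightarrow> v \<in> H \<Longrightarrow> w \<in> H \<Longrightarrow> le u w"
  using lt_trans by blast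

lemma le_iff_not_lt: "u \<in> H \<Longrightarrow> v \<in> H \<Longrightarrow> le u v \<longleftrightarrow> \<not> lt v u"
  using lt_total lt_asym lt_irrefl by blast

lemma above_mono:
  assumes "x \<in> letters" "above x y" "le y z" "y \<in> H" "z \<in> H"
  shows "above x z"
proof (cases x)
  case (Odd u)
  show ?thesis
  proof (cases u)
    case (Br a b c)
    then have "c \<in> H" using assms(1) Odd by (simp add: above_Br_H)
    then show ?thesis using assms Odd Br le_trans[of c y z] by simp
  qed (simp add: Odd)
next
  case (Even u v)
  then show ?thesis using assms le_trans[of v y z] by auto
qed

text \<open>The last entry of a bracket has smaller degree, so it lies below the bracket and hence
  below \<open>y\<close>.\<close>

lemma above_Odd:
  assumes "u \<in> H" "le u y" "y \<in> H"
  shows "above (Odd u) y"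
proof (cases u)
  case (Br a b c)
  then have c: "c \<in> H" using assms(1) by (simp add: above_Br_H)
  have "lt c u" using assms(1) c deg_pos[of a] Br by (intro deg_lt) simp_all
  then have "lt c y" using assms c lt_trans[of c u y] by auto
  then show ?thesis using Br by simp
qed simp

lemma bracket_letters:
  "x \<in> letters \<Longrightarrow> y \<in> H \<Longrightarrow> above x y \<Longrightarrow> exceeds x y \<Longrightarrow> bracket x y \<in> letters"
  by (cases x) (auto simp: above_Br_H)

lemma above_bracket: "above (bracket x y) z \<longleftrightarrow> le y z"
  by (cases x) auto

subsection \<open>Unique factorization of words\<close>

text \<open>Reads a word from the right and inserts each of its letters as a generator; intended as
  a left inverse of \<open>words\<close> on normal lists.\<close>

definition factor :: "'c list \<Rightarrow> 'c letter list \<Rightarrow> 'c letter list" where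
  "factor w n = foldr (\<lambda>c. ins (Odd (Gen c))) w n"

lemma factor_append: "factor (v @ w) n = factor v (factor w n)"
  by (simp add: factor_def)

lemma normal_Odd_Cons:
  assumes "normal n" "u \<in> H" "\<forall>y\<in>odds n. le u y"
  shows "normal (Odd u # n)" and "ins (Odd u) n = Odd u # n"
proof -
  have "\<not> lt y u" if "y \<in> odds n" for y
    using that assms normal_odds[of n] le_iff_not_lt[of u y] by blast
  then show "ins (Odd u) n = Odd u # n" by (intro ins_eq_Cons) simp
  show "normal (Odd u # n)"
    using \<open>\<And>y. y \<in> odds n \<Longrightarrow> \<not> lt y u\<close> assms normal_odds[of n] by (auto intro: above_Odd)
qed

text \<open>For \<open>u = [a,b,c]\<close>, the entries satisfy \<open>b <= c\<close> and
  \<open>c\<close> is at most every odd letter of \<open>n\<close>, so \<open>c\<close> and then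
  \<open>b\<close> stay in front unchanged. Now \<open>a\<close> exceeds \<open>b\<close> and
  absorbs it, the resulting even letter absorbs \<open>c\<close>, and \<open>Odd u\<close> goes on
  into \<open>n\<close>.\<close>

lemma factor_word:
  assumes "u \<in> H" "normal n" "\<forall>y\<in>odds n. above (Odd u) y"
  shows "factor (word u) n = ins (Odd u) n"
  using assms
proof (induction u arbitrary: n)
  case (Gen c)
  then show ?case by (simp add: factor_def)
next
  case (Br a b c)
  note H = Br.prems(1)[unfolded above_Br_H]
  have odds: "odds n \<subseteq> H" using Br.prems normal_odds by blast
  have c: "\<forall>y\<in>odds n. le c y" using Br.prems by simp
  then have b: "\<forall>y\<in>odds n. le b y"
    using H odds le_trans[of b c] by blast
  have nc: "normal (Odd c # n)" "ins (Odd c) n = Odd c # n"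
    using normal_Odd_Cons[of n c] Br.prems H c by auto
  have nb: "normal (Odd b # Odd c # n)" "ins (Odd b) (Odd c # n) = Odd b # Odd c # n"
    using normal_Odd_Cons[of "Odd c # n" b] nc H b by auto
  have "factor (word (Br a b c)) n = factor (word a) (factor (word b) (factor (word c) n))"
    by (simp add: factor_append)
  also have "factor (word c) n = Odd c # n"
    using Br.IH(3)[of n] Br.prems H c odds nc by (auto intro: above_Odd)
  also have "factor (word b) (Odd c # n) = Odd b # Odd c # n"
    using Br.IH(2)[of "Odd c # n"] nb nc H b odds by (auto intro: above_Odd)
  also have "factor (word a) (Odd b # Odd c # n) = ins (Odd a) (Odd b # Odd c # n)"
  proof (rule Br.IH(1)[OF _ nb(1)])
    show "\<forall>y\<in>odds (Odd b # Odd c # n). above (Odd a) y"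
      using H b odds above_mono[of "Odd a" b] by auto
  qed (use H in auto)
  also have "\<dots> = ins (Odd (Br a b c)) n"
    using H by simp
  finally show ?case .
qed

lemma factor_lword:
  assumes "x \<in> letters" "normal n" "\<forall>y\<in>odds n. above x y"
  shows "factor (lword x) n = ins x n"
proof (cases x)
  case (Odd u)
  then show ?thesis using assms factor_word by simp
next
  case (Even u v)
  have odds: "odds n \<subseteq> H" using assms normal_odds by blast
  have H: "u \<in> H" "v \<in> H" "lt v u" "above (Odd u) v" using assms Even by auto
  have v: "\<forall>y\<in>odds n. le v y" using assms Even by simp
  have nv: "normal (Odd v # n)" "ins (Odd v) n = Odd v # n"
    using normal_Odd_Cons[of n v] assms H v by auto
  have "factor (lword x) n = factor (word u) (factor (word v) n)"
    by (simp add: Even factor_append)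
  also have "factor (word v) n = Odd v # n"
    using factor_word[of v n] assms H v odds nv by (auto intro: above_Odd)
  also have "factor (word u) (Odd v # n) = ins (Odd u) (Odd v # n)"
    using H v odds above_mono[of "Odd u" v] by (intro factor_word nv) auto
  also have "\<dots> = ins x n" using H Even by simp
  finally show ?thesis .
qed

text \<open>In a normal list no letter exceeds an odd letter to its right, so reading the word back
  rebuilds each letter and stops there. Hence \<open>words\<close> is injective on normal
  lists.\<close>

lemma factor_words: "normal n \<Longrightarrow> factor (words n) [] = n"
proof (induction n)
  case Nil
  then show ?case by (simp add: factor_def)
next
  case (Cons x n)
  then have "factor (words (x # n)) [] = ins x n"
    using factor_lword[of x n] by (simp add: factor_append)
  then show ?case using Cons.prems ins_eq_Cons[of n x] by simp
qed

subsection \<open>Straightening\<close>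

text \<open>Lower bounds for the odd letters that a letter can give rise to. An even letter imposes
  none, because the triple it forms with \<open>y\<close> lies above \<open>y\<close>.\<close>

primrec below :: "'c mag3 \<Rightarrow> 'c letter \<Rightarrow> bool" where
  "below z (Odd u) \<longleftrightarrow> le z u"
| "below z (Even u v) \<longleftrightarrow> True"

text \<open>The lower bound in the last conjunct is what allows a smaller odd letter to be put back in front.\<close>

definition straight :: "'c letter \<Rightarrow> 'c letter list \<Rightarrow> 'c letter list set" where
  "straight x n = {n'. normal n' \<and> mset (words n') = mset (lword x @ words n) \<and>
     (\<forall>z\<in>H. below z x \<longrightarrow> (\<forall>y\<in>odds n. le z y) \<longrightarrow> (\<forall>y\<in>odds n'. le z y))}"

text \<open>Induction on the list: both terms of \<open>x y = y x + [x,y]\<close> move a letter into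
  the shorter list \<open>n\<close>, namely \<open>x\<close> itself or \<open>[x,y]\<close>.\<close>

lemma ins_span:
  assumes "x \<in> letters" "normal n" "\<forall>y\<in>odds n. above x y"
  shows "(val x * vals n :: 'c list \<Rightarrow>\<^sub>0 'k::field) \<in> PM.span (vals ` straight x n)"
  using assms
proof (induction n arbitrary: x)
  case Nil
  then have "[x] \<in> straight x []"
    by (cases x) (auto simp: straight_def)
  then have "vals [x] \<in> PM.span (vals ` straight x [])"
    by (intro PM.span_base imageI)
  then show ?case by simp
next
  case (Cons l n x)
  show ?case
  proof (cases "\<forall>y\<in>odds (l # n). \<not> exceeds x y")
    case True
    then have "x # l # n \<in> straight x (l # n)"
      using Cons.prems by (cases x; cases l) (auto simp: straight_def)
    then have "vals (x # l # n) \<in> PM.span (vals ` straight x (l # n))"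
      by (intro PM.span_base imageI)
    then show ?thesis by simp
  next
    case False
    have odds: "odds (l # n) \<subseteq> H" using Cons.prems normal_odds by blast
    \<comment> \<open>An even head of a normal list excludes odd letters behind it, so there would
      be nothing for \<open>x\<close> to exceed.\<close>
    obtain y where l: "l = Odd y"
      using False Cons.prems by (cases l) (auto simp: odds_def)
    then have y: "y \<in> H" "normal n" "\<forall>z\<in>odds n. le y z"
      using Cons.prems odds le_iff_not_lt[of y] by auto
    \<comment> \<open>The odd letters increase, so exceeding any of them means exceeding the first
      one, \<open>y\<close>.\<close>
    have drop: "exceeds x y"
    proof (cases x)
      case (Odd u)
      then obtain z where z: "z \<in> insert y (odds n)" "lt z u" using False l by auto
      then have "le y z" "z \<in> H" "u \<in> H" using y odds l Cons.prems Odd by auto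
      then show ?thesis
        using Odd y z(2) lt_trans[of y z u] by auto
    qed simp
    have ax: "above x y" using Cons.prems l by simp
    let ?S = "vals ` straight x (l # n) :: ('c list \<Rightarrow>\<^sub>0 'k) set"
    have 1: "val (bracket x y) * vals n \<in> PM.span ?S"
    proof -
      have "val (bracket x y) * vals n \<in> PM.span (vals ` straight (bracket x y) n :: ('c list \<Rightarrow>\<^sub>0 'k) set)"
        using Cons.prems y ax drop by (intro Cons.IH bracket_letters) (auto simp: above_bracket)
      moreover have "straight (bracket x y) n \<subseteq> straight x (l # n)"
      proof
        fix n' assume n': "n' \<in> straight (bracket x y) n"
        \<comment> \<open>Lower bounds pass to the bracket: \<open>[u,v,y]\<close> has larger degree
          than \<open>y\<close>, so it is above \<open>z\<close>.\<close>
        have "below z (bracket x y)" if "z \<in> H" "le z y" for z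
        proof (cases x)
          case (Even u v)
          have "Br u v y \<in> H" using bracket_letters[of x y] Cons.prems y ax drop Even by simp
          moreover from this have "lt y (Br u v y)"
            using deg_pos[of u] y by (intro deg_lt) auto
          ultimately have "lt z (Br u v y)" using that y lt_trans[of z y] by blast
          then show ?thesis using Even by simp
        qed simp
        then show "n' \<in> straight x (l # n)"
          using n' l unfolding straight_def by auto
      qed
      ultimately show ?thesis
        using PM.span_mono[OF image_mono] by blast
    qed
    have 2: "lie y * (val x * vals n) \<in> PM.span ?S"
    proof -
      have "val x * vals n \<in> PM.span (vals ` straight x n :: ('c list \<Rightarrow>\<^sub>0 'k) set)"
        using Cons.prems y l by (intro Cons.IH) auto
      moreover have "PM.span (vals ` straight x n) \<subseteq> {p :: 'c list \<Rightarrow>\<^sub>0 'k. lie y * p \<in> PM.span ?S}"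
      proof (rule PM.span_minimal)
        show "PM.subspace {p :: 'c list \<Rightarrow>\<^sub>0 'k. lie y * p \<in> PM.span ?S}"
          unfolding PM.subspace_def
          by (auto simp: distrib_left scl_mult_right intro: PM.span_zero PM.span_add PM.span_scale)
        show "vals ` straight x n \<subseteq> {p :: 'c list \<Rightarrow>\<^sub>0 'k. lie y * p \<in> PM.span ?S}"
        proof clarify
          fix n' assume n': "n' \<in> straight x n"
          \<comment> \<open>As \<open>y\<close> bounds \<open>x\<close> and the odd letters of
            \<open>n\<close> from below, it also bounds those of \<open>n'\<close>, and can be put
            back in front.\<close>
          have "below y x" using drop by (cases x) auto
          then have yn': "\<forall>z\<in>odds n'. le y z"
            using n' y unfolding straight_def by blast
          then have "normal (Odd y # n')"
            using n' y by (intro normal_Odd_Cons) (auto simp: straight_def)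
          then have "Odd y # n' \<in> straight x (l # n)"
            using n' l unfolding straight_def by auto
          then have "vals (Odd y # n') \<in> PM.span ?S"
            by (intro PM.span_base imageI)
          then show "lie y * vals n' \<in> PM.span ?S" by simp
        qed
      qed
      ultimately show ?thesis by blast
    qed
    have "(val x * vals (l # n) :: 'c list \<Rightarrow>\<^sub>0 'k) = lie y * (val x * vals n) + val (bracket x y) * vals n"
      by (simp add: l val_bracket commutator_def algebra_simps)
    with PM.span_add[OF 2 1] show ?thesis by (simp only:)
  qed
qed

text \<open>Letters are multiplied in from the left one at a time. Recording the multiset of letters
  keeps the later count of products finite.\<close>

lemma word_span:
  assumes "set w \<subseteq> C"
  shows "(bv w :: 'c list \<Rightarrow>\<^sub>0 'k::field) \<in> PM.span (vals ` {n. normal n \<and> mset (words n) = mset w})"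
  using assms
proof (induction w)
  case Nil
  have "(bv [] :: 'c list \<Rightarrow>\<^sub>0 'k) = vals []"
    using single_one[where ?'a = "'c list" and ?'b = 'k] by (simp add: zero_list_def)
  then show ?case by (auto intro!: PM.span_base image_eqI[of _ _ "[]"])
next
  case (Cons c w)
  let ?N = "\<lambda>w. {n. normal n \<and> mset (words n) = mset w}"
  let ?S = "vals ` ?N (c # w) :: ('c list \<Rightarrow>\<^sub>0 'k) set"
  have c: "Gen c \<in> H" using Cons.prems Gen_H by simp
  have "PM.span (vals ` ?N w) \<subseteq> {p :: 'c list \<Rightarrow>\<^sub>0 'k. bv [c] * p \<in> PM.span ?S}"
  proof (rule PM.span_minimal)
    show "PM.subspace {p :: 'c list \<Rightarrow>\<^sub>0 'k. bv [c] * p \<in> PM.span ?S}"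
      unfolding PM.subspace_def
      by (auto simp: distrib_left scl_mult_right intro: PM.span_zero PM.span_add PM.span_scale)
    show "vals ` ?N w \<subseteq> {p :: 'c list \<Rightarrow>\<^sub>0 'k. bv [c] * p \<in> PM.span ?S}"
    proof clarify
      fix n assume n: "normal n" "mset (words n) = mset w"
      have 1: "val (Odd (Gen c)) * vals n \<in> PM.span (vals ` straight (Odd (Gen c)) n :: ('c list \<Rightarrow>\<^sub>0 'k) set)"
        using n c by (intro ins_span) auto
      have "straight (Odd (Gen c)) n \<subseteq> ?N (c # w)"
        using n by (auto simp: straight_def)
      from subsetD[OF PM.span_mono[OF image_mono[OF this]] 1]
      show "bv [c] * vals n \<in> PM.span ?S"
        by simp
    qed
  qed
  moreover have "bv w \<in> PM.span (vals ` ?N w :: ('c list \<Rightarrow>\<^sub>0 'k) set)"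
    using Cons by simp
  moreover have "(bv (c # w) :: 'c list \<Rightarrow>\<^sub>0 'k) = bv [c] * bv w"
    by (simp add: mult_single plus_list_def)
  ultimately show ?case by auto
qed

text \<open>A dimension count: a nontrivial relation would make one normal product redundant,
  leaving fewer products than words although their span contains all these words.\<close>

lemma lie_independent:
  fixes p :: "'c mag3 \<Rightarrow>\<^sub>0 'k::field"
  assumes keys: "Poly_Mapping.keys p \<subseteq> H" and zero: "lext lie p = 0"
  shows "p = 0"
proof (rule ccontr)
  assume "p \<noteq> 0"
  then obtain h where h: "h \<in> Poly_Mapping.keys p" by fastforce
  let ?K = "Poly_Mapping.keys p"
  \<comment> \<open>All multidegrees occurring in \<open>p\<close> are treated together, so
    \<open>p\<close> is not split into homogeneous components.\<close>
  define W where "W = {w. mset w \<in> (\<lambda>t. mset (word t)) ` ?K}"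
  define N where "N = {n. normal n \<and> mset (words n) \<in> (\<lambda>t. mset (word t)) ` ?K}"
  have gens: "set (word t) = gens t" for t :: "'c mag3"
    by (induction t) auto
  have finW: "finite W"
  proof -
    have "W = (\<Union>t\<in>?K. {w. mset w = mset (word t)})" by (auto simp: W_def)
    then show ?thesis by (simp add: mset_eq_finite)
  qed
  \<comment> \<open>\<open>factor\<close> recovers every normal list from its word, which gives
    \<open>card N <= card W\<close>.\<close>
  have "N \<subseteq> (\<lambda>w. factor w []) ` W"
  proof
    fix n assume "n \<in> N"
    then show "n \<in> (\<lambda>w. factor w []) ` W"
      using factor_words[of n] by (intro image_eqI[of _ _ "words n"]) (auto simp: N_def W_def)
  qed
  then have finN: "finite N" and cardN: "card N \<le> card W"
    using finW finite_subset surj_card_le by (blast, blast)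
  let ?V = "vals :: _ \<Rightarrow> 'c list \<Rightarrow>\<^sub>0 'k"
  have H_N: "[Odd t] \<in> N" if "t \<in> ?K" for t
    using that keys by (auto simp: N_def)
  have V1: "?V [Odd t] = lie t" for t by simp
  let ?B = "?V ` (N - {[Odd h]})"
  \<comment> \<open>The coefficient of \<open>h\<close> is nonzero, so the relation can be solved
    for \<open>lie h\<close>.\<close>
  have "lie h \<in> PM.span ?B"
  proof -
    have "0 = (\<Sum>t\<in>?K. scl (Poly_Mapping.lookup p t) (lie t :: 'c list \<Rightarrow>\<^sub>0 'k))"
      using zero by (simp add: lext_def)
    also have "\<dots> = scl (Poly_Mapping.lookup p h) (lie h) +
        (\<Sum>t\<in>?K - {h}. scl (Poly_Mapping.lookup p t) (lie t))"
      using h by (intro sum.remove) auto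
    finally have "scl (Poly_Mapping.lookup p h) (lie h) =
        - (\<Sum>t\<in>?K - {h}. scl (Poly_Mapping.lookup p t) (lie t :: 'c list \<Rightarrow>\<^sub>0 'k))"
      by (simp add: eq_neg_iff_add_eq_0)
    also have "\<dots> \<in> PM.span ?B"
    proof (intro PM.span_neg PM.span_sum PM.span_scale)
      fix t assume "t \<in> ?K - {h}"
      then have "?V [Odd t] \<in> ?B" using H_N by (intro imageI) auto
      then show "lie t \<in> PM.span ?B" unfolding V1 by (rule PM.span_base)
    qed
    finally have "scl (inverse (Poly_Mapping.lookup p h)) (scl (Poly_Mapping.lookup p h) (lie h)) \<in> PM.span ?B"
      by (rule PM.span_scale)
    then show ?thesis using h by (simp add: in_keys_iff)
  qed
  then have VN: "?V n \<in> PM.span ?B" if "n \<in> N" for n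
    using that V1[of h] by (cases "n = [Odd h]") (auto intro: PM.span_base)
  have "bv ` W \<subseteq> PM.span ?B"
  proof
    fix q :: "'c list \<Rightarrow>\<^sub>0 'k" assume "q \<in> bv ` W"
    then obtain w t where w: "q = bv w" "t \<in> ?K" "mset w = mset (word t)"
      by (auto simp: W_def)
    have "set w \<subseteq> C"
      using w keys H_Mag3 gens[of t] mset_eq_setD[OF w(3)] by (auto simp: Mag3_def)
    then have "q \<in> PM.span (?V ` {n. normal n \<and> mset (words n) = mset w})"
      unfolding w(1) by (rule word_span)
    also have "\<dots> \<subseteq> PM.span ?B"
      using w VN by (intro PM.span_minimal PM.subspace_span) (auto simp: N_def)
    finally show "q \<in> PM.span ?B" .
  qed
  \<comment> \<open>Now \<open>card W\<close> independent vectors lie in the span of fewer than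
    \<open>card N\<close> vectors, against \<open>cardN\<close>.\<close>
  from PM.independent_span_bound[OF _ independent_bv this] finN
  have "card (bv ` W :: ('c list \<Rightarrow>\<^sub>0 'k) set) \<le> card ?B" by simp
  then have "card W \<le> card ?B"
    by (simp add: card_image inj_on_subset[OF inj_bv])
  also have "\<dots> \<le> card (N - {[Odd h]})"
    using finN by (intro card_image_le) auto
  also have "\<dots> < card N"
    using finN H_N[OF h] by (intro card_Diff1_less)
  finally show False using cardN by simp
qed

end

section \<open>The quotient\<close>

abbreviation coset :: "'c set \<Rightarrow> ('c mag3 \<Rightarrow>\<^sub>0 'k::field) \<Rightarrow> ('c mag3 \<Rightarrow>\<^sub>0 'k) set" where
  "coset C p \<equiv> a_r_coset (Alg3 C) (LTS_ideal C) p"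

lemma mem_coset: "q \<in> coset C p \<longleftrightarrow> q - p \<in> LTS_ideal C"
  unfolding coset_eq by (auto intro: exI[of _ "q - p"])

lemma coset_eq_iff: "coset C p = coset C q \<longleftrightarrow> p - q \<in> LTS_ideal C"
proof
  assume "coset C p = coset C q"
  moreover have "p \<in> coset C p"
    by (simp add: mem_coset PM.subspace_0[OF subspace_LTS_ideal])
  ultimately show "p - q \<in> LTS_ideal C" by (simp add: mem_coset)
next
  assume pq: "p - q \<in> LTS_ideal C"
  have "r - p \<in> LTS_ideal C \<longleftrightarrow> r - q \<in> LTS_ideal C" for r
    using PM.subspace_add[OF subspace_LTS_ideal _ pq, of "r - p"]
      PM.subspace_diff[OF subspace_LTS_ideal _ pq, of "r - q"] by auto
  then show "coset C p = coset C q" by (auto simp: mem_coset)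
qed

lemma coset_0: "coset C 0 = LTS_ideal C"
  by (auto simp: mem_coset)

lemma coset_add: "set_add (Alg3 C) (coset C p) (coset C q) = coset C (p + q)"
proof
  show "set_add (Alg3 C) (coset C p) (coset C q) \<subseteq> coset C (p + q)"
  proof
    fix r assume "r \<in> set_add (Alg3 C) (coset C p) (coset C q)"
    then obtain x y where r: "r = x + y" "x - p \<in> LTS_ideal C" "y - q \<in> LTS_ideal C"
      by (auto simp: set_add_def set_mult_def mem_coset)
    then have "(x - p) + (y - q) \<in> LTS_ideal C"
      by (intro PM.subspace_add[OF subspace_LTS_ideal])
    then show "r \<in> coset C (p + q)" by (simp add: mem_coset r(1) algebra_simps)
  qed
  show "coset C (p + q) \<subseteq> set_add (Alg3 C) (coset C p) (coset C q)"
  proof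
    fix r assume "r \<in> coset C (p + q)"
    then have "r - q \<in> coset C p" "q \<in> coset C q"
      by (simp_all add: mem_coset PM.subspace_0[OF subspace_LTS_ideal] algebra_simps)
    then have "\<exists>x\<in>coset C p. \<exists>y\<in>coset C q. r = x + y"
      by (intro bexI[of _ "r - q"] bexI[of _ q]) simp_all
    then show "r \<in> set_add (Alg3 C) (coset C p) (coset C q)"
      unfolding set_add_def set_mult_def by simp
  qed
qed

text \<open>All representatives of a coset scale into the same coset, and there is at least one, so
  the union in the definition collapses.\<close>

lemma coset_scl: "k \<odot>\<^bsub>LTS C\<^esub> coset C p = coset C (scl k p)"
proof -
  have eq: "coset C (scl k q) = coset C (scl k p)" if "q \<in> coset C p" for q
    using that PM.subspace_scale[OF subspace_LTS_ideal, of "q - p" C k]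
    by (simp add: mem_coset coset_eq_iff PM.scale_right_diff_distrib)
  have "coset C p \<noteq> {}"
    using mem_coset[of p C p] PM.subspace_0[OF subspace_LTS_ideal] by auto
  moreover have "k \<odot>\<^bsub>LTS C\<^esub> coset C p = (\<Union>q\<in>coset C p. coset C (scl k p))"
    unfolding LTS_simps Alg3_simps by (intro SUP_cong refl eq)
  ultimately show ?thesis by simp
qed

lemma carrier_LTS: "carrier (LTS C) = coset C ` carrier (Alg3 C)"
  by (auto simp: A_RCOSETS_def RCOSETS_def a_r_coset_def)

text \<open>Coefficients are indexed by residue classes. Injectivity keeps the classes of
  \<open>A\<close> distinct, so the sum lifts term by term to \<open>Alg3 C\<close>.\<close>

lemma finsum_LTS:
  fixes a :: "('c mag3 \<Rightarrow>\<^sub>0 'k::field) set \<Rightarrow> 'k"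
  assumes "finite A" "inj_on (residue C :: _ \<Rightarrow> ('c mag3 \<Rightarrow>\<^sub>0 'k) set) A" "A \<subseteq> Mag3 C"
  shows "finsum (LTS C) (\<lambda>X. a X \<odot>\<^bsub>LTS C\<^esub> X) (residue C ` A) =
    coset C (\<Sum>t\<in>A. Poly_Mapping.single t (a (residue C t)))"
proof -
  interpret V: vectorspace "class_ring :: 'k ring" "LTS C :: ('k, ('c mag3 \<Rightarrow>\<^sub>0 'k) set) module"
    by (rule vectorspace_LTS)
  have res: "a (residue C t) \<odot>\<^bsub>LTS C\<^esub> residue C t = coset C (Poly_Mapping.single t (a (residue C t)))" for t
    by (simp add: residue_def coset_scl scl_single del: LTS_simps)
  have cl: "a (residue C t) \<odot>\<^bsub>LTS C\<^esub> residue C t \<in> carrier (LTS C)" if "t \<in> Mag3 C" for t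
    using that unfolding res carrier_LTS by (intro imageI) simp
  show ?thesis
    using assms
  proof (induction A)
    case empty
    then show ?case by (simp add: coset_0)
  next
    case (insert t A)
    have "finsum (LTS C) (\<lambda>X. a X \<odot>\<^bsub>LTS C\<^esub> X) (residue C ` insert t A) =
      a (residue C t) \<odot>\<^bsub>LTS C\<^esub> residue C t \<oplus>\<^bsub>LTS C\<^esub>
      finsum (LTS C) (\<lambda>X. a X \<odot>\<^bsub>LTS C\<^esub> X) (residue C ` A)"
      unfolding image_insert
    proof (rule V.M.finsum_insert)
      show "residue C t \<notin> (residue C ` A :: ('c mag3 \<Rightarrow>\<^sub>0 'k) set set)"
        using insert.prems(1) insert.hyps by simp
      show "(\<lambda>X. a X \<odot>\<^bsub>LTS C\<^esub> X) \<in> residue C ` A \<rightarrow> carrier (LTS C)"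
        using insert.prems cl by (auto simp del: LTS_simps)
      show "a (residue C t) \<odot>\<^bsub>LTS C\<^esub> residue C t \<in> carrier (LTS C)"
        using insert.prems cl by (auto simp del: LTS_simps)
    qed (use insert in simp)
    also have "finsum (LTS C) (\<lambda>X. a X \<odot>\<^bsub>LTS C\<^esub> X) (residue C ` A) =
        coset C (\<Sum>t\<in>A. Poly_Mapping.single t (a (residue C t)))"
      using insert by (intro insert.IH) auto
    also have "a (residue C t) \<odot>\<^bsub>LTS C\<^esub> residue C t \<oplus>\<^bsub>LTS C\<^esub> \<dots> =
        coset C (\<Sum>t\<in>insert t A. Poly_Mapping.single t (a (residue C t)))"
      unfolding res using insert.hyps by (simp add: coset_add)
    finally show ?case .
  qed
qed

lemma sum_single: "(\<Sum>t\<in>Poly_Mapping.keys p. Poly_Mapping.single t (Poly_Mapping.lookup p t)) = p"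
  for p :: "'a \<Rightarrow>\<^sub>0 'k::field"
  using lext_bv[of p] by (simp add: lext_def scl_single)

text \<open>\<open>lext lie\<close> kills the ideal and has trivial kernel on the vectors supported
  in \<open>H\<close>.\<close>

lemma (in hall_triples) LTS_ideal_Hall:
  assumes "p \<in> LTS_ideal C" "Poly_Mapping.keys p \<subseteq> H" shows "p = 0"
  using assms lie_independent LTS_ideal_lie by blast

text \<open>The span of a union is the sum of the spans, and the ideal is its own span.\<close>

lemma (in hall_triples) Hall_mod_ideal:
  fixes p :: "'c mag3 \<Rightarrow>\<^sub>0 'k::field"
  assumes "p \<in> carrier (Alg3 C)"
  obtains q where "Poly_Mapping.keys q \<subseteq> H" "p - q \<in> LTS_ideal C"
proof -
  have "p \<in> PM.span (bv ` H \<union> LTS_ideal C)"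
    using assms carrier_aspan by blast
  then obtain q m where "q \<in> PM.span (bv ` H)" "m \<in> PM.span (LTS_ideal C)" "p = q + m"
    unfolding PM.span_Un by auto
  then show ?thesis
    using that[of q] by (simp add: keys_subset_iff_span PM.span_eq_iff[THEN iffD2, OF subspace_LTS_ideal])
qed

theorem proposition4p2:
  fixes C :: "'c set" and H :: "'c mag3 set" and lt :: "'c mag3 \<Rightarrow> 'c mag3 \<Rightarrow> bool"
  assumes "hall_triple_set C H lt"
  shows "inj_on (residue C :: 'c mag3 \<Rightarrow> ('c mag3 \<Rightarrow>\<^sub>0 'k::field) set) H \<and>
    vectorspace.basis (class_ring :: 'k ring) (LTS C)
      ((residue C :: 'c mag3 \<Rightarrow> ('c mag3 \<Rightarrow>\<^sub>0 'k) set) ` H)"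
proof -
  interpret hall_triples C H lt by unfold_locales (rule assms)
  interpret V: vectorspace "class_ring :: 'k ring" "LTS C :: ('k, ('c mag3 \<Rightarrow>\<^sub>0 'k) set) module"
    by (rule vectorspace_LTS)
  let ?res = "residue C :: 'c mag3 \<Rightarrow> ('c mag3 \<Rightarrow>\<^sub>0 'k) set"
  have inj: "inj_on ?res H"
  proof (rule inj_onI)
    fix s t assume st: "s \<in> H" "t \<in> H" "?res s = ?res t"
    \<comment> \<open>The difference lies in the ideal and its support is contained in
      \<open>{s, t}\<close>.\<close>
    have "bv s - bv t = (0 :: 'c mag3 \<Rightarrow>\<^sub>0 'k)"
      using st keys_diff[of "bv s" "bv t :: 'c mag3 \<Rightarrow>\<^sub>0 'k"]
      by (intro LTS_ideal_Hall) (auto simp: residue_def coset_eq_iff)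
    then show "s = t" using inj_bv[where 'k='k] by (auto dest: injD)
  qed
  have sub: "?res ` H \<subseteq> carrier (LTS C)"
    unfolding carrier_LTS residue_def using H_Mag3 by auto
  have indep: "\<not> V.lin_dep (?res ` H)"
  proof
    assume "V.lin_dep (?res ` H)"
    then obtain A a X where A: "finite A" "A \<subseteq> ?res ` H" "V.lincomb a A = LTS_ideal C"
      and X: "X \<in> A" "a X \<noteq> 0"
      unfolding V.lin_dep_def by auto
    then obtain B where B: "B \<subseteq> H" "finite B" "A = ?res ` B"
      by (meson finite_subset_image)
    then obtain t where t: "t \<in> B" "X = ?res t" using X by blast
    \<comment> \<open>A lift of the vanishing combination to \<open>Alg3 C\<close>; its coefficient
      at \<open>t\<close> is \<open>a X\<close>, which is nonzero.\<close>
    let ?p = "\<Sum>t\<in>B. Poly_Mapping.single t (a (?res t))"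
    have "coset C ?p = coset C 0"
      using finsum_LTS[of B C a] A B H_Mag3 inj_on_subset[OF inj, of B]
      unfolding V.lincomb_def coset_0 by (simp del: LTS_simps)
    moreover have "Poly_Mapping.keys ?p \<subseteq> H"
      using B by (intro order_trans[OF keys_sum]) auto
    ultimately have "?p = 0"
      by (intro LTS_ideal_Hall) (simp_all add: coset_eq_iff)
    then have "Poly_Mapping.lookup ?p t = 0" by simp
    then show False
      using t X B by (simp add: lookup_sum lookup_single when_def)
  qed
  have "V.span (?res ` H) = carrier (LTS C)"
  proof
    show "V.span (?res ` H) \<subseteq> carrier (LTS C)"
      using V.span_is_subset2[OF sub] .
    show "carrier (LTS C) \<subseteq> V.span (?res ` H)"
    proof
      fix X assume "X \<in> carrier (LTS C :: ('k, ('c mag3 \<Rightarrow>\<^sub>0 'k) set) module)"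
      then obtain p where p: "p \<in> carrier (Alg3 C)" "X = coset C p"
        unfolding carrier_LTS by blast
      from Hall_mod_ideal[OF p(1)] obtain q where q: "Poly_Mapping.keys q \<subseteq> H" "p - q \<in> LTS_ideal C" .
      \<comment> \<open>Combinations are indexed by classes, so the coefficients of \<open>q\<close>
        are carried over by the inverse of the residue map on \<open>H\<close>.\<close>
      let ?a = "\<lambda>X. Poly_Mapping.lookup q (inv_into H ?res X)"
      have "V.lincomb ?a (?res ` Poly_Mapping.keys q) =
          coset C (\<Sum>t\<in>Poly_Mapping.keys q. Poly_Mapping.single t (?a (?res t)))"
        unfolding V.lincomb_def using q(1) H_Mag3 by (intro finsum_LTS inj_on_subset[OF inj]) auto
      also have "(\<Sum>t\<in>Poly_Mapping.keys q. Poly_Mapping.single t (?a (?res t))) =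
          (\<Sum>t\<in>Poly_Mapping.keys q. Poly_Mapping.single t (Poly_Mapping.lookup q t))"
        using q(1) by (intro sum.cong refl) (simp add: inv_into_f_f[OF inj] subset_iff)
      also have "\<dots> = q" by (rule sum_single)
      also have "coset C q = X" unfolding p(2) using q(2) by (rule coset_eq_iff[THEN iffD2, symmetric])
      finally have "X = V.lincomb ?a (?res ` Poly_Mapping.keys q)" ..
      then show "X \<in> V.span (?res ` H)"
        unfolding V.span_def using q(1) by (auto intro!: exI[of _ ?a] exI[of _ "?res ` Poly_Mapping.keys q"])
    qed
  qed
  with inj indep sub show ?thesis by (simp add: V.basis_def)
qed

end
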